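(* Let $k\ge2$ be an integer, let $p\ge2$ be real, let $\varepsilon>0$ and let $C\ge 0$. There is a constant $K_{k,p,\varepsilon,C}>0$, depending only on $k,p,\varepsilon,C$, such that for every integer $N\ge1$, every real sequence $\{\theta_n\}_{n=0}^N$ with $\sup_{0\le n\le N}|\theta_n|\le C$, and all complex numbers $a_0,\dots,a_N$, $$\left\|\sum_{n=0}^N a_n e^{2\pi i\left(nx+(n^k+\theta_n)t\right)}\right\|_{L^p([0,1]^2)}\le K_{k,p,\varepsilon,C}\,N^{\varepsilon}\left(1+N^{\frac12-\frac3p}\right)\left(\sum_{n=0}^N|a_n|^2\right)^{\frac12}.$$
   Context: The $L^p([0,1]^2)$ norm is taken in the real variables $(x,t)\in[0,1]^2$ with respect to Lebesgue measure. *)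

theory Defs
  imports "HOL-Analysis.Analysis"
begin

(* Meaningful for 0 < p < infinity and f such that |f|^p is integrable over M;
   otherwise the Bochner integral takes its default value 0. *)
definition Lp_norm :: "real \<Rightarrow> 'a measure \<Rightarrow> ('a \<Rightarrow> 'b::real_normed_vector) \<Rightarrow> real" where
  "Lp_norm p M f = (\<integral>z. norm (f z) powr p \<partial>M) powr (1 / p)"

end

theory Submission
  imports Defs "HOL-Computational_Algebra.Computational_Algebra"
begin

text \<open>The heart of the matter is the exponent 6; larger \<open>p\<close> follow by interpolation with the supremum norm,
  smaller \<open>p\<close> because the unit square has measure 1. From here on \<open>p\<close> is a fixed prime
  larger than \<open>k\<close>. On a finite grid, which is enough
  after translating it over a small square, the sixth moment is estimated by a \<open>p\<close>-adic bilinear argument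
  (efficient congruencing). Let \<open>F\<^sub>S\<close> be the part of the exponential sum with frequencies
  in a set \<open>S\<close> of integers prime to \<open>p\<close> and contained in one residue class modulo \<open>p\<^sup>b\<close>.
  By Minkowski's inequality in \<open>L\<^sup>3\<close>, \<open>|F\<^sub>S|\<^sup>2\<close> is controlled by the subclasses
  modulo \<open>p\<^sup>b\<^sup>+\<^sup>1\<close> and by mixed moments of \<open>|F\<^sub>S|\<^sup>2|F\<^sub>T|\<^sup>4\<close> over distinct subclasses. If \<open>T\<close> lies in a class
  modulo \<open>p\<^sup>B\<close>, the curvature of \<open>n\<^sup>k\<close> makes the pieces of \<open>F\<^sub>S\<close> belonging to different classes modulo
  \<open>p\<^sup>2\<^sup>B\<^sup>-\<^sup>b\<close> orthogonal with respect to the weight \<open>|F\<^sub>T|\<^sup>4\<close>. Cauchy--Schwarz then exchanges the roles of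
  \<open>S\<close> and \<open>T\<close>, at the cost of a square root of a sixth moment at a finer scale; iterating the exchange gains
  an arbitrarily large power, which beats the loss of a factor \<open>p\<close> in the Minkowski step.\<close>

section \<open>Congruences for powers\<close>

lemma power_Taylor_dvd:
  fixes q t D :: int
  assumes "q dvd D"
  shows "q ^ 2 dvd (t + D) ^ k - (t ^ k + of_nat k * t ^ (k - 1) * D)"
proof (induction k)
  case 0
  then show ?case by simp
next
  case (Suc k)
  define P :: int where "P = of_nat k * t ^ (k - 1)"
  \<comment> \<open>Subtraction in \<open>k - 1\<close> is truncated; at \<open>k = 0\<close> the
    identity survives because the factor \<open>of_nat k\<close> vanishes.\<close>
  have tP: "P * t = of_nat k * t ^ k"
    unfolding P_def by (cases k) auto
  have "(t + D) ^ Suc k - (t ^ Suc k + of_nat (Suc k) * t ^ (Suc k - 1) * D)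
      = (t + D) * ((t + D) ^ k - (t ^ k + P * D)) + (P * t - of_nat k * t ^ k) * D + P * D\<^sup>2"
    by (simp add: algebra_simps power2_eq_square)
  moreover have "q ^ 2 dvd P * D\<^sup>2"
    using assms by (intro dvd_mult) (simp add: power2_eq_square mult_dvd_mono)
  moreover have "q ^ 2 dvd (t + D) * ((t + D) ^ k - (t ^ k + P * D))"
    using Suc.IH unfolding P_def by (rule dvd_mult)
  ultimately show ?case
    by (simp only: tP diff_self mult_zero_left add_0_right dvd_add)
qed

text \<open>The product rule gives the quotient by induction, and the first-order Taylor formula
  controls its error modulo \<open>q ^ 2\<close>. The congruence concerns \<open>2 * h\<close> so
  that no coefficient has to be halved, and \<open>h\<close> is existential so that
  \<open>D = D'\<close> is allowed.\<close>

lemma power_difference_quotient_dvd: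
  fixes q t D D' :: int
  assumes "q dvd D" "q dvd D'"
  shows "\<exists>h. (t + D) ^ k - (t + D') ^ k = (D - D') * h \<and>
     q ^ 2 dvd 2 * h - (2 * of_nat k * t ^ (k - 1)
        + of_nat (k * (k - 1)) * t ^ (k - 2) * (D + D'))"
proof (induction k)
  case 0
  then show ?case by (intro exI[of _ 0]) simp
next
  case (Suc k)
  then obtain h where h: "(t + D) ^ k - (t + D') ^ k = (D - D') * h"
    and hq: "q ^ 2 dvd 2 * h - (2 * of_nat k * t ^ (k - 1)
        + of_nat (k * (k - 1)) * t ^ (k - 2) * (D + D'))" by blast
  define h' where "h' = (t + D) ^ k + (t + D') * h"
  have "(t + D) ^ Suc k - (t + D') ^ Suc k
      = (D - D') * (t + D) ^ k + (t + D') * ((t + D) ^ k - (t + D') ^ k)"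
    by (simp add: algebra_simps)
  also have "\<dots> = (D - D') * h'"
    unfolding h h'_def by (simp add: algebra_simps)
  finally have 1: "(t + D) ^ Suc k - (t + D') ^ Suc k = (D - D') * h'" .
  define P :: int where "P = of_nat k * t ^ (k - 1)"
  define R :: int where "R = of_nat (k * (k - 1)) * t ^ (k - 2)"
  have tP: "P * t = of_nat k * t ^ k" unfolding P_def by (cases k) auto
  have tR: "R * t = of_nat (k - 1) * P" unfolding R_def P_def
  proof (cases "k \<ge> 2")
    case True
    then obtain m where "k = Suc (Suc m)" by (metis Suc_le_D numeral_2_eq_2 Suc_le_mono)
    then show "of_nat (k * (k - 1)) * t ^ (k - 2) * t = of_nat (k - 1) * (of_nat k * t ^ (k - 1))"
      by (simp add: algebra_simps)
  next
    case False
    hence "k = 0 \<or> k = 1" by auto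
    then show "of_nat (k * (k - 1)) * t ^ (k - 2) * t = of_nat (k - 1) * (of_nat k * t ^ (k - 1))"
      by auto
  qed
  have kk: "of_nat (Suc k * (Suc k - 1)) * t ^ (Suc k - 2) = R * t + 2 * P"
    unfolding tR P_def by (cases k) (auto simp: algebra_simps)
  \<comment> \<open>The four summands are a Taylor error, the induction hypothesis, a term that is
    zero by \<open>tP\<close>, and a remainder in which both \<open>D + D'\<close> and
    \<open>D'\<close> are divisible by \<open>q\<close>.\<close>
  have E: "2 * h' - (2 * of_nat (Suc k) * t ^ (Suc k - 1)
        + of_nat (Suc k * (Suc k - 1)) * t ^ (Suc k - 2) * (D + D'))
     = 2 * ((t + D) ^ k - (t ^ k + P * D)) + (t + D') * (2 * h - (2 * P + R * (D + D')))
       + 2 * (P * t - of_nat k * t ^ k) + R * (D + D') * D'"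
    unfolding kk h'_def by (simp add: algebra_simps)
  have "q ^ 2 dvd R * (D + D') * D'"
    using assms by (simp add: power2_eq_square mult.assoc dvd_mult mult_dvd_mono)
  moreover have "q ^ 2 dvd (t + D') * (2 * h - (2 * P + R * (D + D')))"
    using hq by (intro dvd_mult) (simp add: P_def R_def mult.assoc)
  moreover have "q ^ 2 dvd 2 * ((t + D) ^ k - (t ^ k + P * D))"
    using power_Taylor_dvd[OF assms(1)] by (intro dvd_mult) (simp add: P_def)
  moreover have "q ^ 2 dvd 2 * (P * t - of_nat k * t ^ k)"
    by (simp add: tP)
  ultimately have "q ^ 2 dvd 2 * h' - (2 * of_nat (Suc k) * t ^ (Suc k - 1)
        + of_nat (Suc k * (Suc k - 1)) * t ^ (Suc k - 2) * (D + D'))"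
    unfolding E by (intro dvd_add)
  with 1 show ?case by (intro exI[of _ h'] conjI)
qed

text \<open>Curvature: modulo \<open>p\<^sup>2\<^sup>b\<close> the difference quotient of \<open>x\<^sup>k - k t\<^sup>k\<^sup>-\<^sup>1 x\<close> at \<open>s, s'\<close>
  is \<open>k (k - 1) / 2 * t\<^sup>k\<^sup>-\<^sup>2 ((s - t) + (s' - t))\<close>, of exact valuation \<open>b\<close>; this is where
  \<open>p > k\<close> and \<open>1 \<le> b\<close> are needed.\<close>

lemma congruence_gain:
  fixes p b B k :: nat and s s' t :: int
  assumes p: "prime p" "k < p" and k: "2 \<le> k" and b: "1 \<le> b" "b \<le> 2 * B"
    and t: "\<not> int p dvd t"
    and st: "int p ^ b dvd s - t" "\<not> int p ^ Suc b dvd s - t"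
    and ss: "int p ^ Suc b dvd s - s'"
    and main: "int p ^ (2 * B) dvd s ^ k - s' ^ k - of_nat k * t ^ (k - 1) * (s - s')"
  shows "int p ^ (2 * B - b) dvd s - s'"
proof -
  define q where "q = int p ^ b"
  have q0: "q \<noteq> 0" using p by (auto simp: q_def)
  have pp: "prime (int p)" using p by simp
  obtain u where u: "s - t = q * u" using st(1) by (auto simp: q_def)
  have pu: "\<not> int p dvd u"
    using st(2) unfolding u by (simp add: q_def mult.commute)
  obtain w where "s - s' = int p ^ Suc b * w" using ss by (rule dvdE)
  hence w: "s - s' = q * (int p * w)" by (simp add: q_def)
  have "s' - t = q * (u - int p * w)" using u w by (simp add: algebra_simps)
  hence "q dvd s' - t" by simp
  then obtain h where h: "(t + (s - t)) ^ k - (t + (s' - t)) ^ k = ((s - t) - (s' - t)) * h"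
    and hq: "q ^ 2 dvd 2 * h - (2 * of_nat k * t ^ (k - 1)
        + of_nat (k * (k - 1)) * t ^ (k - 2) * ((s - t) + (s' - t)))"
    using power_difference_quotient_dvd[of q "s - t" "s' - t" t k] u by auto
  from hq obtain Z where Z: "2 * h = 2 * of_nat k * t ^ (k - 1)
        + of_nat (k * (k - 1)) * t ^ (k - 2) * ((s - t) + (s' - t)) + q ^ 2 * Z"
    by (metis add.commute diff_add_cancel dvd_def)
  have sum: "(s - t) + (s' - t) = q * (2 * u - int p * w)"
    using u w by (simp add: algebra_simps)
  \<comment> \<open>Twice the difference quotient minus its constant part
    \<open>2 * of_nat k * t ^ (k - 1)\<close> equals \<open>q * V\<close>. Everything reduces to
    \<open>V\<close> being prime to \<open>p\<close>; the factor \<open>2 * u - int p * w\<close>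
    is, because \<open>u\<close> is and \<open>p\<close> exceeds 2.\<close>
  define V where "V = of_nat (k * (k - 1)) * t ^ (k - 2) * (2 * u - int p * w) + q * Z"
  have "2 * (s ^ k - s' ^ k - of_nat k * t ^ (k - 1) * (s - s'))
      = (s - s') * (2 * h - 2 * of_nat k * t ^ (k - 1))"
    using h by (simp add: algebra_simps)
  also have "\<dots> = (s - s') * V * q"
    unfolding Z sum V_def by (simp add: algebra_simps power2_eq_square)
  finally have "int p ^ (2 * B) dvd (s - s') * V * q"
    using main by (metis dvd_mult)
  moreover have "int p ^ (2 * B) = int p ^ (2 * B - b) * q"
    using b by (simp add: q_def flip: power_add)
  ultimately have d: "int p ^ (2 * B - b) dvd (s - s') * V" using q0 by simp
  have "\<not> int p dvd V"
  proof
    assume "int p dvd V"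
    moreover have "int p dvd q * Z" using b by (simp add: q_def dvd_power)
    ultimately have "int p dvd of_nat (k * (k - 1)) * t ^ (k - 2) * (2 * u - int p * w)"
      by (simp add: V_def dvd_add_left_iff)
    hence "int p dvd of_nat (k * (k - 1)) \<or> int p dvd t ^ (k - 2) \<or> int p dvd 2 * u - int p * w"
      using pp by (simp add: prime_dvd_mult_iff)
    moreover have "\<not> int p dvd int m" if "0 < m" "m < p" for m
      using that by (simp add: nat_dvd_not_less)
    from this[of k] this[of "k - 1"] have "\<not> int p dvd of_nat (k * (k - 1))"
      using p k pp by (simp only: of_nat_mult prime_dvd_mult_iff) auto
    moreover have "\<not> int p dvd t ^ (k - 2)" using t pp by (meson prime_dvd_power)
    moreover have "\<not> int p dvd 2 * u - int p * w"
    proof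
      assume "int p dvd 2 * u - int p * w"
      hence "int p dvd 2 * u" by (simp add: dvd_diff_left_iff)
      hence "int p dvd 2" using pp pu by (simp add: prime_dvd_mult_iff)
      hence "p dvd 2" by (metis int_dvd_int_iff of_nat_numeral)
      thus False using p k by (auto dest: dvd_imp_le)
    qed
    ultimately show False by blast
  qed
  hence "coprime (int p ^ (2 * B - b)) V" using pp by (simp add: prime_imp_coprime)
  with d show ?thesis by (simp add: coprime_dvd_mult_left_iff)
qed

section \<open>Convexity inequalities for finite sums\<close>

lemma convex_on_power_nonneg: "convex_on {0::real..} (\<lambda>x. x ^ m)"
proof (cases "even m")
  case True
  then show ?thesis using convex_power_even convex_on_subset by blast
next
  case False
  then show ?thesis using convex_power_odd by blast
qed

text \<open>Jensen's inequality for the normalised weights \<open>l i / L\<close>, where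
  \<open>L\<close> is the total weight.\<close>

lemma weighted_power_mean:
  fixes l x :: "'i \<Rightarrow> real"
  assumes "finite I" "\<And>i. i \<in> I \<Longrightarrow> l i > 0" "\<And>i. i \<in> I \<Longrightarrow> x i \<ge> 0"
  shows "(\<Sum>i\<in>I. l i * x i) ^ Suc m \<le> (\<Sum>i\<in>I. l i) ^ m * (\<Sum>i\<in>I. l i * x i ^ Suc m)"
proof (cases "I = {}")
  case False
  define L where "L = (\<Sum>i\<in>I. l i)"
  have L: "L > 0" unfolding L_def using assms False by (simp add: sum_pos)
  have "(\<Sum>i\<in>I. (l i / L) *\<^sub>R x i) ^ Suc m \<le> (\<Sum>i\<in>I. (l i / L) * x i ^ Suc m)"
    by (rule convex_on_sum[OF assms(1) False convex_on_power_nonneg])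
      (use assms L in \<open>auto simp: L_def less_imp_le simp flip: sum_divide_distrib\<close>)
  hence "(\<Sum>i\<in>I. l i * x i) ^ Suc m / L ^ Suc m \<le> (\<Sum>i\<in>I. l i * x i ^ Suc m) / L"
    by (simp add: sum_divide_distrib[symmetric] power_divide)
  hence "(\<Sum>i\<in>I. l i * x i) ^ Suc m \<le> (\<Sum>i\<in>I. l i * x i ^ Suc m) / L * L ^ Suc m"
    using L by (subst (asm) pos_divide_le_eq) auto
  thus ?thesis using L by (simp add: L_def mult_ac)
qed simp

text \<open>Minkowski's inequality for the exponent \<open>Suc m\<close>, stated without roots:
  \<open>c * l i ^ Suc m\<close> bounds a power of the norm of \<open>g i\<close>. Writing
  \<open>g i\<close> as \<open>l i * (g i / l i)\<close> reduces it to the weighted power mean at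
  each point.\<close>

lemma Minkowski_finite_sum:
  fixes g :: "'i \<Rightarrow> 'w \<Rightarrow> real"
  assumes fin: "finite I" "finite W" and g: "\<And>i w. i \<in> I \<Longrightarrow> w \<in> W \<Longrightarrow> g i w \<ge> 0"
    and l: "\<And>i. i \<in> I \<Longrightarrow> l i \<ge> 0"
    and bound: "\<And>i. i \<in> I \<Longrightarrow> (\<Sum>w\<in>W. g i w ^ Suc m) \<le> c * l i ^ Suc m"
    and c: "c \<ge> 0"
  shows "(\<Sum>w\<in>W. (\<Sum>i\<in>I. g i w) ^ Suc m) \<le> c * (\<Sum>i\<in>I. l i) ^ Suc m"
proof -
  \<comment> \<open>Indices with \<open>l i = 0\<close> must go before dividing by
    \<open>l i\<close>; for them the bound forces \<open>g i\<close> to vanish on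
    \<open>W\<close>.\<close>
  define I' where "I' = {i\<in>I. l i > 0}"
  have fin': "finite I'" using fin by (simp add: I'_def)
  have zero: "g i w = 0" if "i \<in> I" "l i = 0" "w \<in> W" for i w
  proof -
    have "(\<Sum>w\<in>W. g i w ^ Suc m) = 0"
      using bound[OF that(1)] g[OF that(1)] that(2) by (intro antisym sum_nonneg) auto
    hence "g i w ^ Suc m = 0"
      using fin g[OF that(1)] that(3) sum_nonneg_eq_0_iff[of W "\<lambda>w. g i w ^ Suc m"] by auto
    thus ?thesis by (metis power_not_zero)
  qed
  define L where "L = (\<Sum>i\<in>I'. l i)"
  have LL: "(\<Sum>i\<in>I. l i) = L" unfolding L_def I'_def
    by (rule sum.mono_neutral_right) (use fin l in \<open>force simp: not_less intro: antisym\<close>)+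
  have L0: "L \<ge> 0" unfolding L_def I'_def by (intro sum_nonneg) auto
  have "(\<Sum>w\<in>W. (\<Sum>i\<in>I. g i w) ^ Suc m)
      \<le> (\<Sum>w\<in>W. L ^ m * (\<Sum>i\<in>I'. l i * (g i w / l i) ^ Suc m))"
  proof (rule sum_mono)
    fix w assume w: "w \<in> W"
    have "(\<Sum>i\<in>I. g i w) = (\<Sum>i\<in>I'. g i w)" unfolding I'_def
      by (rule sum.mono_neutral_right) (use fin l zero w in \<open>force simp: not_less intro: antisym\<close>)+
    also have "\<dots> = (\<Sum>i\<in>I'. l i * (g i w / l i))"
      by (rule sum.cong) (auto simp: I'_def)
    finally show "(\<Sum>i\<in>I. g i w) ^ Suc m \<le> L ^ m * (\<Sum>i\<in>I'. l i * (g i w / l i) ^ Suc m)"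
      unfolding L_def using weighted_power_mean[OF fin', of l "\<lambda>i. g i w / l i" m] g w
      by (auto simp: I'_def)
  qed
  also have "\<dots> = L ^ m * (\<Sum>i\<in>I'. l i * ((\<Sum>w\<in>W. g i w ^ Suc m) / l i ^ Suc m))"
    by (simp only: sum_distrib_left[symmetric] sum.swap[of _ _ W] power_divide
        sum_divide_distrib[symmetric])
  also have "\<dots> \<le> L ^ m * (\<Sum>i\<in>I'. l i * c)"
    by (intro mult_left_mono sum_mono)
      (use L0 bound in \<open>auto simp: I'_def pos_divide_le_eq\<close>)
  also have "\<dots> = c * L ^ Suc m"
    unfolding sum_distrib_right[symmetric] L_def[symmetric] by simp
  finally show ?thesis by (simp add: LL)
qed

text \<open>Hoelder's inequality with exponents 3 and 3/2: after normalising by \<open>m\<close> and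
  \<open>n\<close>, which must therefore be positive, it is the pointwise inequality
  \<open>amgm\<close>.\<close>

lemma sum_mult_square_le:
  fixes x y :: "'w \<Rightarrow> real"
  assumes "finite W" "\<And>w. w \<in> W \<Longrightarrow> x w \<ge> 0" "\<And>w. w \<in> W \<Longrightarrow> y w \<ge> 0"
    and x: "(\<Sum>w\<in>W. x w ^ 3) \<le> c * m ^ 3" and y: "(\<Sum>w\<in>W. y w ^ 3) \<le> c * n ^ 3"
    and "c \<ge> 0" "m > 0" "n > 0"
  shows "(\<Sum>w\<in>W. x w * (y w)\<^sup>2) \<le> c * m * n\<^sup>2"
proof -
  have amgm: "3 * (u * v\<^sup>2) \<le> u ^ 3 + 2 * v ^ 3" if "u \<ge> 0" "v \<ge> 0" for u v :: real
  proof -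
    have "0 \<le> (u - v)\<^sup>2 * (u + 2 * v)" using that by simp
    also have "\<dots> = u ^ 3 + 2 * v ^ 3 - 3 * (u * v\<^sup>2)"
      by (simp add: algebra_simps power2_eq_square power3_eq_cube)
    finally show ?thesis by simp
  qed
  have "3 * (\<Sum>w\<in>W. x w / m * (y w / n)\<^sup>2)
      \<le> (\<Sum>w\<in>W. (x w / m) ^ 3 + 2 * (y w / n) ^ 3)"
    unfolding sum_distrib_left by (intro sum_mono amgm) (use assms in auto)
  also have "\<dots> = (\<Sum>w\<in>W. x w ^ 3) / m ^ 3 + 2 * ((\<Sum>w\<in>W. y w ^ 3) / n ^ 3)"
    by (simp add: sum.distrib power_divide sum_divide_distrib sum_distrib_left)
  also have "\<dots> \<le> c + 2 * c"
    by (intro add_mono mult_left_mono) (use assms in \<open>auto simp: pos_divide_le_eq\<close>)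
  finally have "(\<Sum>w\<in>W. x w / m * (y w / n)\<^sup>2) \<le> c" by simp
  moreover have "(\<Sum>w\<in>W. x w / m * (y w / n)\<^sup>2) = (\<Sum>w\<in>W. x w * (y w)\<^sup>2) / (m * n\<^sup>2)"
    by (simp add: sum_divide_distrib power_divide)
  ultimately show ?thesis using assms by (simp add: pos_divide_le_eq mult_ac)
qed

section \<open>Bilinear reduction to congruence classes\<close>

lemma card_residues_le:
  fixes p b c :: nat and S :: "int set"
  assumes "b \<le> c" "p > 0" and S: "\<And>x y. x \<in> S \<Longrightarrow> y \<in> S \<Longrightarrow> int p ^ b dvd x - y"
  shows "card ((\<lambda>x. x mod int p ^ c) ` S) \<le> p ^ (c - b)"
proof (cases "S = {}")
  case False
  then obtain x0 where x0: "x0 \<in> S" by auto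
  have "(\<lambda>x. x mod int p ^ c) ` S \<subseteq> (\<lambda>i. (x0 + int p ^ b * int i) mod int p ^ c) ` {..<p ^ (c - b)}"
  proof (rule image_subsetI)
    fix x assume "x \<in> S"
    then obtain u where u: "x - x0 = int p ^ b * u" using S x0 by (meson dvdE)
    define m where "m = int p ^ (c - b)"
    define i where "i = nat (u mod m)"
    have m: "m > 0" using assms by (simp add: m_def)
    have pc: "int p ^ c = int p ^ b * m" using assms by (simp add: m_def flip: power_add)
    have "x = x0 + int p ^ b * (u mod m) + int p ^ b * (m * (u div m))"
      using u by (simp flip: distrib_left add: add.assoc)
    also have "\<dots> = x0 + int p ^ b * int i + int p ^ c * (u div m)"
      using m by (simp add: i_def pc)
    finally have "x mod int p ^ c = (x0 + int p ^ b * int i) mod int p ^ c"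
      by simp
    moreover have "i < p ^ (c - b)"
      using m pos_mod_bound[of m u] by (simp add: i_def m_def nat_less_iff)
    ultimately show "x mod int p ^ c \<in> (\<lambda>i. (x0 + int p ^ b * int i) mod int p ^ c) ` {..<p ^ (c - b)}"
      by blast
  qed
  hence "card ((\<lambda>x. x mod int p ^ c) ` S) \<le> card {..<p ^ (c - b)}"
    by (meson surj_card_le finite_lessThan)
  thus ?thesis by simp
qed simp

text \<open>The interface between the \<open>p\<close>-adic argument and the grid characters.
  Orthogonality is recorded only modulo \<open>p ^ (2 * M)\<close>, which suffices because scales
  never exceed \<open>M\<close>; \<open>distinct\<close> limits each class modulo
  \<open>p ^ M\<close> to one frequency, so that the trivial bound can close the induction.\<close>

locale padic_system =
  fixes Omega :: "'w set" and e :: "int \<Rightarrow> 'w \<Rightarrow> complex" and a :: "int \<Rightarrow> complex"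
    and X :: "int set" and p k M :: nat
  assumes fin: "finite Omega" "finite X"
    and p: "prime p" "k < p" and k: "2 \<le> k"
    and norm_e: "\<And>n w. w \<in> Omega \<Longrightarrow> cmod (e n w) = 1"
    and unit: "\<And>n. n \<in> X \<Longrightarrow> \<not> int p dvd n"
    and distinct: "\<And>x y. x \<in> X \<Longrightarrow> y \<in> X \<Longrightarrow> int p ^ M dvd x - y \<Longrightarrow> x = y"
    and orthogonal: "\<And>s s' t1 t2 t3 t4. s \<in> X \<Longrightarrow> s' \<in> X \<Longrightarrow> t1 \<in> X \<Longrightarrow> t2 \<in> X \<Longrightarrow> t3 \<in> X \<Longrightarrow> t4 \<in> X
      \<Longrightarrow> (\<Sum>w\<in>Omega. e s w * cnj (e s' w) * (e t1 w * e t2 w * cnj (e t3 w * e t4 w))) \<noteq> 0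
      \<Longrightarrow> int p ^ (2 * M) dvd s - s' + t1 + t2 - t3 - t4
        \<and> int p ^ (2 * M) dvd s ^ k - s' ^ k + t1 ^ k + t2 ^ k - t3 ^ k - t4 ^ k"
begin

definition F :: "int set \<Rightarrow> 'w \<Rightarrow> complex" where
  "F S w = (\<Sum>n\<in>S. a n * e n w)"

definition mass :: "int set \<Rightarrow> real" where
  "mass S = (\<Sum>n\<in>S. (cmod (a n))\<^sup>2)"

definition congruent :: "nat \<Rightarrow> int set \<Rightarrow> bool" where
  "congruent c S \<longleftrightarrow> (\<forall>x\<in>S. \<forall>y\<in>S. int p ^ c dvd x - y)"

definition separated :: "nat \<Rightarrow> int set \<Rightarrow> int set \<Rightarrow> bool" where
  "separated b S T \<longleftrightarrow> (\<forall>s\<in>S. \<forall>t\<in>T. int p ^ b dvd s - t \<and> \<not> int p ^ Suc b dvd s - t)"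

definition moment_bound :: "nat \<Rightarrow> real \<Rightarrow> bool" where
  "moment_bound b c \<longleftrightarrow> (\<forall>S\<subseteq>X. congruent b S \<longrightarrow> (\<Sum>w\<in>Omega. cmod (F S w) ^ 6) \<le> c * mass S ^ 3)"

text \<open>\<open>A\<close> is the scale of the factor of degree 2 and \<open>B\<close> that of the
  factor of degree 4. During the iteration \<open>b\<close> stays fixed while these two scales
  move.\<close>

definition mixed_bound :: "nat \<Rightarrow> nat \<Rightarrow> nat \<Rightarrow> real \<Rightarrow> bool" where
  "mixed_bound b A B c \<longleftrightarrow> (\<forall>S\<subseteq>X. \<forall>T\<subseteq>X. congruent A S \<longrightarrow> congruent B T \<longrightarrow> separated b S T \<longrightarrow>
     (\<Sum>w\<in>Omega. (cmod (F S w))\<^sup>2 * cmod (F T w) ^ 4) \<le> c * mass S * (mass T)\<^sup>2)"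

abbreviation cls :: "nat \<Rightarrow> int set \<Rightarrow> int \<Rightarrow> int set" where
  "cls c S r \<equiv> {x \<in> S. x mod int p ^ c = r}"

abbreviation residues :: "nat \<Rightarrow> int set \<Rightarrow> int set" where
  "residues c S \<equiv> (\<lambda>x. x mod int p ^ c) ` S"

lemma p_pos: "p > 0"
  using p by (simp add: prime_gt_0_nat)

lemma mass_nonneg: "mass S \<ge> 0"
  by (simp add: mass_def sum_nonneg)

lemma mass_cls: "finite S \<Longrightarrow> (\<Sum>r\<in>residues c S. mass (cls c S r)) = mass S"
  unfolding mass_def by (rule sum.image_gen[symmetric])

lemma F_cls: "finite S \<Longrightarrow> (\<Sum>r\<in>residues c S. F (cls c S r) w) = F S w"
  unfolding F_def by (rule sum.image_gen[symmetric])

lemma F_eq_0: "finite S \<Longrightarrow> mass S = 0 \<Longrightarrow> F S w = 0"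
  unfolding mass_def F_def by (subst (asm) sum_nonneg_eq_0_iff) auto

lemma congruent_cls: "congruent c (cls c S r)"
  unfolding congruent_def by (auto simp flip: mod_eq_dvd_iff)

lemma congruent_le: "congruent c S \<Longrightarrow> b \<le> c \<Longrightarrow> congruent b S"
  unfolding congruent_def by (meson dvd_trans le_imp_power_dvd)

lemma separated_commute: "separated b S T \<Longrightarrow> separated b T S"
  unfolding separated_def by (metis dvd_diff_commute)

lemma moment_bound_mono: "moment_bound b c \<Longrightarrow> c \<le> c' \<Longrightarrow> moment_bound b c'"
  unfolding moment_bound_def using mass_nonneg by (meson mult_right_mono order_trans zero_le_power)

lemma F_square_le: "finite S \<Longrightarrow> w \<in> Omega \<Longrightarrow> (cmod (F S w))\<^sup>2 \<le> mass S * card S"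
proof -
  assume "finite S" "w \<in> Omega"
  have "cmod (F S w) \<le> (\<Sum>n\<in>S. cmod (a n))"
    unfolding F_def using \<open>w \<in> Omega\<close> by (intro sum_norm_le) (simp add: norm_mult norm_e)
  hence "(cmod (F S w))\<^sup>2 \<le> (\<Sum>n\<in>S. cmod (a n))\<^sup>2" by (intro power_mono) auto
  also have "\<dots> \<le> mass S * card S" unfolding mass_def by (rule sum_squared_le_sum_of_squares)
  finally show ?thesis .
qed

section \<open>Orthogonality with respect to fourth powers\<close>

text \<open>The weight expands into products of four characters with frequencies in
  \<open>T\<close>. A nonzero term would give a linear and a \<open>k\<close>-th power congruence;
  since all frequencies in \<open>T\<close> agree modulo \<open>p ^ B\<close>, those of
  \<open>T\<close> can be eliminated modulo \<open>p ^ (2 * B)\<close>, and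
  \<open>congruence_gain\<close> then contradicts the assumption on \<open>s - s'\<close>.\<close>

lemma correlation_eq_0:
  assumes "T \<subseteq> X" "s \<in> X" "s' \<in> X" and b: "1 \<le> b" "b \<le> B" and BM: "B \<le> M"
    and T: "congruent B T" and sT: "separated b {s} T"
    and ss: "int p ^ Suc b dvd s - s'" "\<not> int p ^ (2 * B - b) dvd s - s'"
  shows "(\<Sum>w\<in>Omega. e s w * cnj (e s' w) * of_real (cmod (F T w) ^ 4)) = 0"
proof -
  have finT: "finite T" using assms(1) fin finite_subset by blast
  define u where "u = (\<lambda>(t1, t2). a t1 * a t2)"
  define v where "v = (\<lambda>(t1, t2) w. e t1 w * e t2 w)"
  have F2: "F T w * F T w = (\<Sum>x\<in>T \<times> T. u x * v x w)" for w
    unfolding F_def sum_product sum.cartesian_product u_def v_def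
    by (rule sum.cong) (auto simp: mult_ac)
  have F4: "complex_of_real (cmod (F T w) ^ 4)
      = (\<Sum>xy\<in>(T \<times> T) \<times> (T \<times> T). u (fst xy) * cnj (u (snd xy)) * (v (fst xy) w * cnj (v (snd xy) w)))" for w
  proof -
    have "complex_of_real (cmod (F T w) ^ 4) = (complex_of_real ((cmod (F T w))\<^sup>2))\<^sup>2"
      by (simp flip: power_mult of_real_power)
    also have "\<dots> = (F T w * F T w) * cnj (F T w * F T w)"
      unfolding complex_norm_square by (simp add: power2_eq_square mult_ac)
    also have "\<dots> = (\<Sum>x\<in>T \<times> T. \<Sum>y\<in>T \<times> T. u x * v x w * cnj (u y * v y w))"
      unfolding F2 cnj_sum sum_product ..
    also have "\<dots> = (\<Sum>xy\<in>(T \<times> T) \<times> (T \<times> T).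
        u (fst xy) * cnj (u (snd xy)) * (v (fst xy) w * cnj (v (snd xy) w)))"
      unfolding sum.cartesian_product by (rule sum.cong) (auto simp: mult_ac)
    finally show ?thesis .
  qed
  have "(\<Sum>w\<in>Omega. e s w * cnj (e s' w) * of_real (cmod (F T w) ^ 4))
     = (\<Sum>xy\<in>(T \<times> T) \<times> (T \<times> T). u (fst xy) * cnj (u (snd xy)) *
          (\<Sum>w\<in>Omega. e s w * cnj (e s' w) * (v (fst xy) w * cnj (v (snd xy) w))))"
    unfolding F4 sum_distrib_left by (subst sum.swap) (simp add: mult_ac)
  also have "\<dots> = 0"
  proof (rule sum.neutral, clarify)
    fix t1 t2 t3 t4 assume t: "t1 \<in> T" "t2 \<in> T" "t3 \<in> T" "t4 \<in> T"
    define c where "c = of_nat k * t1 ^ (k - 1)"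
    have "(\<Sum>w\<in>Omega. e s w * cnj (e s' w) * (e t1 w * e t2 w * cnj (e t3 w * e t4 w))) = 0"
    proof (rule ccontr)
      assume "\<not> ?thesis"
      hence "int p ^ (2 * M) dvd s - s' + t1 + t2 - t3 - t4"
        "int p ^ (2 * M) dvd s ^ k - s' ^ k + t1 ^ k + t2 ^ k - t3 ^ k - t4 ^ k"
        using orthogonal[of s s' t1 t2 t3 t4] assms t by auto
      moreover have "int p ^ (2 * B) dvd int p ^ (2 * M)"
        using BM by (intro le_imp_power_dvd) simp
      ultimately have d: "int p ^ (2 * B) dvd s - s' + t1 + t2 - t3 - t4"
        "int p ^ (2 * B) dvd s ^ k - s' ^ k + t1 ^ k + t2 ^ k - t3 ^ k - t4 ^ k"
        using dvd_trans by blast+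
      have Taylor: "int p ^ (2 * B) dvd x ^ k - t1 ^ k - c * (x - t1)" if "x \<in> T" for x
        using power_Taylor_dvd[of "int p ^ B" "x - t1" t1 k] T that t
        by (simp add: c_def congruent_def algebra_simps flip: power_mult)
      \<comment> \<open>Subtracting \<open>c\<close> times the linear congruence from the power
        congruence leaves only first-order Taylor errors at \<open>t1\<close> for \<open>t2\<close>,
        \<open>t3\<close>, \<open>t4\<close>, each divisible by \<open>p ^ (2 * B)\<close>.\<close>
      have "s ^ k - s' ^ k - c * (s - s')
         = (s ^ k - s' ^ k + t1 ^ k + t2 ^ k - t3 ^ k - t4 ^ k) - c * (s - s' + t1 + t2 - t3 - t4)
           - ((t2 ^ k - t1 ^ k - c * (t2 - t1)) - (t3 ^ k - t1 ^ k - c * (t3 - t1))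
           - (t4 ^ k - t1 ^ k - c * (t4 - t1)))"
        by (simp add: algebra_simps)
      moreover have "int p ^ (2 * B) dvd \<dots>"
        by (intro dvd_diff dvd_mult d Taylor t)
      ultimately have "int p ^ (2 * B) dvd s ^ k - s' ^ k - c * (s - s')" by (simp only:)
      hence "int p ^ (2 * B - b) dvd s - s'"
        using sT t ss b p k unit[of t1] assms(1) unfolding c_def separated_def
        by (intro congruence_gain[of p k b B t1]) auto
      thus False using ss by blast
    qed
    thus "u (fst ((t1, t2), t3, t4)) * cnj (u (snd ((t1, t2), t3, t4))) *
        (\<Sum>w\<in>Omega. e s w * cnj (e s' w) *
           (v (fst ((t1, t2), t3, t4)) w * cnj (v (snd ((t1, t2), t3, t4)) w))) = 0"
      by (simp add: v_def)
  qed
  finally show ?thesis .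
qed

lemma square_moment_expand:
  "complex_of_real (\<Sum>w\<in>Omega. (cmod (F S w))\<^sup>2 * h w)
    = (\<Sum>s\<in>S. \<Sum>s'\<in>S. a s * cnj (a s') * (\<Sum>w\<in>Omega. e s w * cnj (e s' w) * of_real (h w)))"
proof -
  have "complex_of_real ((cmod (F S w))\<^sup>2 * h w)
      = (\<Sum>s\<in>S. \<Sum>s'\<in>S. a s * cnj (a s') * (e s w * cnj (e s' w) * of_real (h w)))" for w
  proof -
    have "F S w * cnj (F S w) = (\<Sum>s\<in>S. \<Sum>s'\<in>S. a s * e s w * cnj (a s' * e s' w))"
      unfolding F_def cnj_sum sum_product ..
    thus ?thesis
      unfolding of_real_mult complex_norm_square by (simp add: sum_distrib_left mult_ac)
  qed
  hence "complex_of_real (\<Sum>w\<in>Omega. (cmod (F S w))\<^sup>2 * h w)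
      = (\<Sum>w\<in>Omega. \<Sum>s\<in>S. \<Sum>s'\<in>S. a s * cnj (a s') * (e s w * cnj (e s' w) * of_real (h w)))"
    by simp
  also have "\<dots> = (\<Sum>s\<in>S. \<Sum>s'\<in>S. \<Sum>w\<in>Omega. a s * cnj (a s') * (e s w * cnj (e s' w) * of_real (h w)))"
    unfolding sum.swap[of _ S Omega] ..
  finally show ?thesis by (simp add: sum_distrib_left)
qed

text \<open>Cross terms between different classes modulo \<open>p ^ (2 * B - b)\<close> are the
  correlations shown to vanish; \<open>congruent (Suc b) S\<close> supplies the initial closeness of
  \<open>s\<close> and \<open>s'\<close> needed for that.\<close>

lemma mixed_moment_cls:
  assumes S: "S \<subseteq> X" and T: "T \<subseteq> X" and b: "1 \<le> b" "b \<le> B" and BM: "B \<le> M"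
    and cS: "congruent (Suc b) S" and cT: "congruent B T" and sep: "separated b S T"
  shows "(\<Sum>w\<in>Omega. (cmod (F S w))\<^sup>2 * cmod (F T w) ^ 4)
    = (\<Sum>r\<in>residues (2 * B - b) S. \<Sum>w\<in>Omega. (cmod (F (cls (2 * B - b) S r) w))\<^sup>2 * cmod (F T w) ^ 4)"
proof -
  have finS: "finite S" using S fin finite_subset by blast
  define c where "c = 2 * B - b"
  define W where "W s s' = a s * cnj (a s') *
     (\<Sum>w\<in>Omega. e s w * cnj (e s' w) * of_real (cmod (F T w) ^ 4))" for s s'
  have W0: "W s s' = 0" if "s \<in> S" "s' \<in> S" "s mod int p ^ c \<noteq> s' mod int p ^ c" for s s'
    unfolding W_def using that S cS sep c_def
    by (subst correlation_eq_0[OF T _ _ b BM cT])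
      (auto simp: separated_def congruent_def mod_eq_dvd_iff)
  have "complex_of_real (\<Sum>w\<in>Omega. (cmod (F S w))\<^sup>2 * cmod (F T w) ^ 4) = (\<Sum>s\<in>S. \<Sum>s'\<in>S. W s s')"
    unfolding square_moment_expand W_def ..
  also have "\<dots> = (\<Sum>r\<in>residues c S. \<Sum>s\<in>cls c S r. \<Sum>s'\<in>S. W s s')"
    by (rule sum.image_gen[OF finS])
  also have "\<dots> = (\<Sum>r\<in>residues c S. \<Sum>s\<in>cls c S r. \<Sum>s'\<in>cls c S r. W s s')"
    by (intro sum.cong refl sum.mono_neutral_right) (use finS in \<open>auto intro: W0\<close>)
  also have "\<dots> = (\<Sum>r\<in>residues c S.
      complex_of_real (\<Sum>w\<in>Omega. (cmod (F (cls c S r) w))\<^sup>2 * cmod (F T w) ^ 4))"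
    unfolding square_moment_expand W_def ..
  also have "\<dots> = complex_of_real
      (\<Sum>r\<in>residues c S. \<Sum>w\<in>Omega. (cmod (F (cls c S r) w))\<^sup>2 * cmod (F T w) ^ 4)"
    by (simp only: of_real_sum)
  finally show ?thesis unfolding c_def of_real_eq_iff .
qed

text \<open>Orthogonality costs nothing, since the masses of the classes add up to
  \<open>mass S\<close>: the scale of \<open>S\<close> is relaxed from \<open>2 * B - b\<close> to
  any \<open>A\<close> above \<open>b\<close> with the same constant.\<close>

lemma mixed_bound_cls:
  assumes "mixed_bound b (2 * B - b) B c" "1 \<le> b" "b \<le> B" "B \<le> M" "Suc b \<le> A"
  shows "mixed_bound b A B c"
  unfolding mixed_bound_def
proof (intro allI impI)
  fix S T assume ST: "S \<subseteq> X" "T \<subseteq> X" "congruent A S" "congruent B T" "separated b S T"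
  have finS: "finite S" using ST fin finite_subset by blast
  let ?c = "2 * B - b"
  have "(\<Sum>w\<in>Omega. (cmod (F S w))\<^sup>2 * cmod (F T w) ^ 4)
    = (\<Sum>r\<in>residues ?c S. \<Sum>w\<in>Omega. (cmod (F (cls ?c S r) w))\<^sup>2 * cmod (F T w) ^ 4)"
    using assms ST congruent_le by (intro mixed_moment_cls) auto
  also have "\<dots> \<le> (\<Sum>r\<in>residues ?c S. c * mass (cls ?c S r) * (mass T)\<^sup>2)"
  proof (intro sum_mono)
    fix r
    have "cls ?c S r \<subseteq> X" "separated b (cls ?c S r) T"
      using ST by (auto simp: separated_def)
    thus "(\<Sum>w\<in>Omega. (cmod (F (cls ?c S r) w))\<^sup>2 * cmod (F T w) ^ 4)
        \<le> c * mass (cls ?c S r) * (mass T)\<^sup>2"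
      using assms(1) ST congruent_cls unfolding mixed_bound_def by blast
  qed
  also have "\<dots> = c * mass S * (mass T)\<^sup>2"
    by (simp only: sum_distrib_left[symmetric] sum_distrib_right[symmetric] mass_cls[OF finS])
  finally show "(\<Sum>w\<in>Omega. (cmod (F S w))\<^sup>2 * cmod (F T w) ^ 4) \<le> c * mass S * (mass T)\<^sup>2" .
qed

section \<open>Exchanging the roles of the two classes\<close>

text \<open>The integrand is split as \<open>|F_T| |F_S|^2\<close> times \<open>|F_T|^3\<close>. The
  first square is the mixed moment with \<open>S\<close> and \<open>T\<close> interchanged, the
  second a pure sixth moment of \<open>F_T\<close>, and the masses balance exactly.\<close>

lemma mixed_bound_Cauchy_Schwarz:
  assumes m: "mixed_bound b B A m" and c: "moment_bound B c" and g: "m * c \<le> g\<^sup>2" "0 \<le> g"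
    and "0 \<le> m" "0 \<le> c"
  shows "mixed_bound b A B g"
  unfolding mixed_bound_def
proof (intro allI impI)
  fix S T assume ST: "S \<subseteq> X" "T \<subseteq> X" "congruent A S" "congruent B T" "separated b S T"
  let ?f = "\<lambda>w. cmod (F S w)" and ?g = "\<lambda>w. cmod (F T w)"
  have "(\<Sum>w\<in>Omega. (?f w)\<^sup>2 * ?g w ^ 4)\<^sup>2 = (\<Sum>w\<in>Omega. ?g w * (?f w)\<^sup>2 * ?g w ^ 3)\<^sup>2"
    by (simp add: eval_nat_numeral mult_ac)
  also have "\<dots> \<le> (\<Sum>w\<in>Omega. (?g w * (?f w)\<^sup>2)\<^sup>2) * (\<Sum>w\<in>Omega. (?g w ^ 3)\<^sup>2)"
    by (rule Cauchy_Schwarz_ineq_sum)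
  also have "\<dots> = (\<Sum>w\<in>Omega. (?g w)\<^sup>2 * ?f w ^ 4) * (\<Sum>w\<in>Omega. ?g w ^ 6)"
    by (simp add: power_mult_distrib flip: power_mult)
  also have "\<dots> \<le> (m * mass T * (mass S)\<^sup>2) * (c * mass T ^ 3)"
    using m c ST separated_commute unfolding mixed_bound_def moment_bound_def
    by (intro mult_mono) (auto intro!: sum_nonneg mult_nonneg_nonneg mass_nonneg assms)
  also have "\<dots> = (m * c) * (mass S * (mass T)\<^sup>2)\<^sup>2"
    by (simp add: eval_nat_numeral mult_ac)
  also have "\<dots> \<le> g\<^sup>2 * (mass S * (mass T)\<^sup>2)\<^sup>2"
    by (intro mult_right_mono g) auto
  finally have "(\<Sum>w\<in>Omega. (?f w)\<^sup>2 * ?g w ^ 4)\<^sup>2 \<le> (g * mass S * (mass T)\<^sup>2)\<^sup>2"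
    by (simp add: power_mult_distrib mult_ac)
  thus "(\<Sum>w\<in>Omega. (?f w)\<^sup>2 * ?g w ^ 4) \<le> g * mass S * (mass T)\<^sup>2"
    by (rule power2_le_imp_le) (auto intro!: mult_nonneg_nonneg mass_nonneg g)
qed

text \<open>The start of the iteration, with no gain yet. Zero masses are treated apart because
  Hoelder's inequality was normalised by positive numbers.\<close>

lemma mixed_bound_Hoelder:
  assumes A: "moment_bound A c" and B: "moment_bound B c" and c: "0 \<le> c"
  shows "mixed_bound b A B c"
  unfolding mixed_bound_def
proof (intro allI impI)
  fix S T assume ST: "S \<subseteq> X" "T \<subseteq> X" "congruent A S" "congruent B T" "separated b S T"
  have fin': "finite S" "finite T" using ST fin finite_subset by blast+
  let ?f = "\<lambda>w. cmod (F S w)" and ?g = "\<lambda>w. cmod (F T w)"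
  show "(\<Sum>w\<in>Omega. (?f w)\<^sup>2 * ?g w ^ 4) \<le> c * mass S * (mass T)\<^sup>2"
  proof (cases "mass S = 0 \<or> mass T = 0")
    case True
    hence "(?f w)\<^sup>2 * ?g w ^ 4 = 0" for w using F_eq_0 fin' by fastforce
    hence "(\<Sum>w\<in>Omega. (?f w)\<^sup>2 * ?g w ^ 4) = 0" by (intro sum.neutral) blast
    thus ?thesis using c by (simp add: mass_nonneg)
  next
    case False
    have "(\<Sum>w\<in>Omega. (?f w)\<^sup>2 * ((?g w)\<^sup>2)\<^sup>2) \<le> c * mass S * (mass T)\<^sup>2"
      by (rule sum_mult_square_le)
        (use A B ST c fin False mass_nonneg[of S] mass_nonneg[of T] in
          \<open>auto simp: moment_bound_def less_le simp flip: power_mult\<close>)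
    thus ?thesis by (simp flip: power_mult)
  qed
qed

text \<open>Each exchange doubles \<open>\<beta>\<close> and halves the exponent of the gain already
  obtained, so earlier gains are preserved, while the sixth moment at scale
  \<open>b + \<beta>\<close> contributes a further \<open>r ^ (3 * \<beta>)\<close>. The doubling
  explains the requirement \<open>b + \<beta> * 2 ^ j \<le> M\<close>.\<close>

lemma mixed_bound_iterate:
  assumes "1 \<le> b" and c0: "0 \<le> c0" and r: "1 \<le> r"
    and mb: "\<And>b'. b < b' \<Longrightarrow> b' \<le> M \<Longrightarrow> moment_bound b' (c0 * r ^ (6 * (M - b')))"
  shows "1 \<le> \<alpha> \<Longrightarrow> b + \<alpha> \<le> M \<Longrightarrow> 1 \<le> \<beta> \<Longrightarrow> b + \<beta> * 2 ^ j \<le> M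
    \<Longrightarrow> mixed_bound b (b + \<alpha>) (b + \<beta>) (c0 * r ^ (6 * (M - b)) / r ^ (3 * \<beta> * j))"
proof (induction j arbitrary: \<alpha> \<beta>)
  case 0
  have "moment_bound b' (c0 * r ^ (6 * (M - b)))" if "b < b'" "b' \<le> M" for b'
    by (rule moment_bound_mono[OF mb[OF that]])
      (use c0 r that in \<open>intro mult_left_mono power_increasing; auto\<close>)
  thus ?case using 0 c0 r by (simp add: mixed_bound_Hoelder)
next
  case (Suc j)
  let ?d = "M - b"
  have "\<beta> \<le> \<beta> * 2 ^ Suc j" by (metis mult.right_neutral mult_le_mono2 one_le_numeral one_le_power)
  hence bM: "b + \<beta> \<le> M" using Suc.prems(4) by (meson add_left_mono order_trans)
  have r0: "r > 0" using r by simp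
  \<comment> \<open>The induction hypothesis is used with \<open>\<beta>\<close> in place of
    \<open>\<alpha>\<close> and \<open>2 * \<beta>\<close> in place of \<open>\<beta>\<close>, which
    is the bound for the interchanged classes.\<close>
  have "mixed_bound b (b + \<beta>) (b + 2 * \<beta>) (c0 * r ^ (6 * ?d) / r ^ (3 * (2 * \<beta>) * j))"
    by (rule Suc.IH) (use Suc.prems bM in \<open>auto simp: algebra_simps\<close>)
  moreover have "moment_bound (b + \<beta>) (c0 * r ^ (6 * (M - (b + \<beta>))))"
    using mb bM Suc.prems by auto
  moreover have "c0 * r ^ (6 * ?d) / r ^ (3 * (2 * \<beta>) * j) * (c0 * r ^ (6 * (M - (b + \<beta>))))
      \<le> (c0 * r ^ (6 * ?d) / r ^ (3 * \<beta> * Suc j))\<^sup>2"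
  proof -
    have "6 * ?d = 6 * (M - (b + \<beta>)) + 6 * \<beta>" using bM by simp
    hence "r ^ (6 * (M - (b + \<beta>))) = r ^ (6 * ?d) / r ^ (6 * \<beta>)"
      using r0 by (simp add: power_add)
    moreover have "(r ^ (3 * \<beta> * Suc j))\<^sup>2 = r ^ (3 * (2 * \<beta>) * j) * r ^ (6 * \<beta>)"
      by (simp flip: power_mult power_add add: algebra_simps)
    ultimately show ?thesis by (simp add: power_divide power_mult_distrib power2_eq_square)
  qed
  ultimately have *: "mixed_bound b (b + 2 * \<beta>) (b + \<beta>) (c0 * r ^ (6 * ?d) / r ^ (3 * \<beta> * Suc j))"
    by (rule mixed_bound_Cauchy_Schwarz)
      (intro divide_nonneg_pos mult_nonneg_nonneg c0 zero_le_power zero_less_power r0 less_imp_le[OF r0])+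
  \<comment> \<open>The scale \<open>b + 2 * \<beta>\<close> is exactly the one that orthogonality
    against scale \<open>b + \<beta>\<close> provides, so the first scale may return to
    \<open>b + \<alpha>\<close>.\<close>
  have "2 * (b + \<beta>) - b = b + 2 * \<beta>" by simp
  hence "mixed_bound b (2 * (b + \<beta>) - b) (b + \<beta>) (c0 * r ^ (6 * ?d) / r ^ (3 * \<beta> * Suc j))"
    using * by (simp only:)
  thus ?case
    by (rule mixed_bound_cls) (use Suc.prems(1) assms(1) bM in linarith)+
qed

section \<open>Induction on the scale\<close>

text \<open>Minkowski's inequality in \<open>L^3\<close> is applied to \<open>|F_S|^2\<close>,
  bounded by the sum of \<open>f i * f j\<close> over pairs of subclasses. Diagonal pairs contribute
  \<open>l1\<close> in total and off-diagonal ones at most \<open>p * l2\<close>; the cubes in the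
  hypotheses are those of the \<open>L^3\<close> norms.\<close>

lemma moment_bound_step:
  assumes E: "moment_bound (Suc b) (c * l1 ^ 3)" and mix: "mixed_bound b (Suc b) (Suc b) (c * l2 ^ 3)"
    and l: "0 \<le> c" "0 \<le> l1" "0 \<le> l2" "l1 + real p * l2 \<le> 1"
  shows "moment_bound b c"
  unfolding moment_bound_def
proof (intro allI impI)
  fix S assume S: "S \<subseteq> X" "congruent b S"
  have finS: "finite S" using S fin finite_subset by blast
  define R where "R = residues (Suc b) S"
  define T where "T i = cls (Suc b) S i" for i
  define f where "f i w = cmod (F (T i) w)" for i w
  have finR: "finite R" using finS by (simp add: R_def)
  have T: "T i \<subseteq> X" "congruent (Suc b) (T i)" for i
    using S(1) congruent_cls[of "Suc b" S i] by (auto simp only: T_def)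
  have sep: "separated b (T i) (T j)" if "i \<noteq> j" for i j
    using that S(2) unfolding separated_def T_def congruent_def
    by (metis (mono_tags, lifting) mem_Collect_eq mod_eq_dvd_iff)
  have cardR: "real (card R) \<le> real p"
    using card_residues_le[of b "Suc b" p S] S p_pos by (auto simp: R_def congruent_def)
  have massR: "(\<Sum>i\<in>R. mass (T i)) = mass S"
    unfolding R_def T_def by (rule mass_cls[OF finS])
  define g where "g = (\<lambda>(i, j) w. f i w * f j w)"
  define L where "L = (\<lambda>(i, j). if i = j then l1 * mass (T i) else l2 * sqrt (mass (T i) * mass (T j)))"
  have "(\<Sum>w\<in>Omega. cmod (F S w) ^ 6) \<le> (\<Sum>w\<in>Omega. (\<Sum>x\<in>R \<times> R. g x w) ^ Suc 2)"
  proof (rule sum_mono)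
    fix w
    have "cmod (F S w) \<le> (\<Sum>i\<in>R. f i w)"
      unfolding f_def T_def R_def using F_cls[OF finS, of "Suc b" w] by (metis norm_sum)
    hence "cmod (F S w) ^ 6 \<le> (\<Sum>i\<in>R. f i w) ^ 6" by (intro power_mono) auto
    also have "\<dots> = ((\<Sum>i\<in>R. f i w) * (\<Sum>i\<in>R. f i w)) ^ Suc 2"
      by (simp add: eval_nat_numeral mult_ac)
    also have "\<dots> = (\<Sum>x\<in>R \<times> R. g x w) ^ Suc 2"
      unfolding sum_product sum.cartesian_product g_def by (simp add: split_def)
    finally show "cmod (F S w) ^ 6 \<le> (\<Sum>x\<in>R \<times> R. g x w) ^ Suc 2" .
  qed
  also have "\<dots> \<le> c * (\<Sum>x\<in>R \<times> R. L x) ^ Suc 2"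
  proof (rule Minkowski_finite_sum)
    fix x assume "x \<in> R \<times> R"
    obtain i j where x: "x = (i, j)" by (cases x)
    show "0 \<le> L x" using l mass_nonneg by (auto simp: L_def x)
    show "(\<Sum>w\<in>Omega. g x w ^ Suc 2) \<le> c * L x ^ Suc 2"
    proof (cases "i = j")
      case True
      have "(\<Sum>w\<in>Omega. g x w ^ Suc 2) = (\<Sum>w\<in>Omega. cmod (F (T i) w) ^ 6)"
        by (simp add: g_def x True f_def eval_nat_numeral mult_ac)
      also have "\<dots> \<le> c * l1 ^ 3 * mass (T i) ^ 3"
        using E T unfolding moment_bound_def by blast
      finally show ?thesis by (simp add: L_def x True eval_nat_numeral mult_ac)
    next
      case False
      \<comment> \<open>The cube of \<open>f i * f j\<close> is a product of
        \<open>f i * (f j)^2\<close> and \<open>f j * (f i)^2\<close>, so Cauchy-Schwarz leaves one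
        mixed moment in each order.\<close>
      have "(\<Sum>w\<in>Omega. g x w ^ Suc 2)\<^sup>2
          = (\<Sum>w\<in>Omega. (f i w * (f j w)\<^sup>2) * (f j w * (f i w)\<^sup>2))\<^sup>2"
        by (simp add: g_def x eval_nat_numeral mult_ac)
      also have "\<dots> \<le> (\<Sum>w\<in>Omega. (f i w * (f j w)\<^sup>2)\<^sup>2) * (\<Sum>w\<in>Omega. (f j w * (f i w)\<^sup>2)\<^sup>2)"
        by (rule Cauchy_Schwarz_ineq_sum)
      also have "\<dots> = (\<Sum>w\<in>Omega. (f i w)\<^sup>2 * f j w ^ 4) * (\<Sum>w\<in>Omega. (f j w)\<^sup>2 * f i w ^ 4)"
        by (simp add: power_mult_distrib flip: power_mult)
      also have "\<dots> \<le> (c * l2 ^ 3 * mass (T i) * (mass (T j))\<^sup>2) * (c * l2 ^ 3 * mass (T j) * (mass (T i))\<^sup>2)"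
      proof (intro mult_mono)
        show "(\<Sum>w\<in>Omega. (f i w)\<^sup>2 * f j w ^ 4) \<le> c * l2 ^ 3 * mass (T i) * (mass (T j))\<^sup>2"
          "(\<Sum>w\<in>Omega. (f j w)\<^sup>2 * f i w ^ 4) \<le> c * l2 ^ 3 * mass (T j) * (mass (T i))\<^sup>2"
          unfolding f_def using False
          by (auto intro!: mix[unfolded mixed_bound_def, rule_format] T sep)
      qed (auto intro!: sum_nonneg mult_nonneg_nonneg mass_nonneg l simp: f_def)
      also have "\<dots> = (c * l2 ^ 3)\<^sup>2 * (mass (T i) * mass (T j)) ^ 3"
        by (simp add: eval_nat_numeral mult_ac)
      also have "\<dots> = (c * l2 ^ 3)\<^sup>2 * ((sqrt (mass (T i) * mass (T j)))\<^sup>2) ^ 3"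
        by (simp add: mass_nonneg)
      also have "\<dots> = (c * L x ^ Suc 2)\<^sup>2"
        using False by (simp add: L_def x power_mult_distrib flip: power_mult)
      finally show ?thesis
        by (rule power2_le_imp_le) (use l mass_nonneg in \<open>auto simp: L_def x\<close>)
    qed
  qed (use fin finR l in \<open>auto simp: g_def f_def\<close>)
  also have "\<dots> \<le> c * mass S ^ Suc 2"
  proof (intro mult_left_mono power_mono)
    \<comment> \<open>Adding the missing diagonal to the second part turns it into a full square;
      Cauchy-Schwarz over the at most \<open>p\<close> subclasses then loses the factor
      \<open>p\<close>.\<close>
    have "(\<Sum>x\<in>R \<times> R. L x) \<le> (\<Sum>x\<in>R \<times> R. (\<lambda>(i, j). (if i = j then l1 * mass (T i) else 0)
        + l2 * (sqrt (mass (T i)) * sqrt (mass (T j)))) x)"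
      by (intro sum_mono) (use l mass_nonneg in \<open>auto simp: L_def real_sqrt_mult\<close>)
    also have "\<dots> = l1 * mass S + l2 * (\<Sum>i\<in>R. sqrt (mass (T i)))\<^sup>2"
      unfolding sum.cartesian_product[symmetric] power2_eq_square sum_product massR[symmetric]
      using finR by (simp add: sum.distrib sum_distrib_left)
    also have "\<dots> \<le> l1 * mass S + l2 * ((\<Sum>i\<in>R. (sqrt (mass (T i)))\<^sup>2) * card R)"
      by (intro add_left_mono mult_left_mono sum_squared_le_sum_of_squares l)
    also have "\<dots> = l1 * mass S + l2 * (mass S * card R)"
      by (simp add: mass_nonneg massR)
    also have "\<dots> \<le> l1 * mass S + l2 * (mass S * p)"
      by (intro add_left_mono mult_left_mono l mass_nonneg cardR)
    also have "\<dots> = (l1 + p * l2) * mass S" by (simp add: algebra_simps)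
    also have "\<dots> \<le> 1 * mass S" by (intro mult_right_mono l mass_nonneg)
    finally show "(\<Sum>x\<in>R \<times> R. L x) \<le> mass S" by simp
    show "0 \<le> (\<Sum>x\<in>R \<times> R. L x)" using l mass_nonneg
      by (intro sum_nonneg) (auto simp: L_def)
  qed (use l in auto)
  finally show "(\<Sum>w\<in>Omega. cmod (F S w) ^ 6) \<le> c * mass S ^ 3" by simp
qed

text \<open>A class modulo \<open>p ^ b\<close> contains at most \<open>p ^ (M - b)\<close>
  frequencies, so the pointwise Cauchy-Schwarz bound gives this.\<close>

lemma moment_bound_trivial:
  assumes "b \<le> M"
  shows "moment_bound b (card Omega * real p ^ (3 * (M - b)))"
  unfolding moment_bound_def
proof (intro allI impI)
  fix S assume S: "S \<subseteq> X" "congruent b S"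
  have finS: "finite S" using S fin finite_subset by blast
  have "inj_on (\<lambda>x. x mod int p ^ M) S"
    using S distinct by (auto simp: inj_on_def mod_eq_dvd_iff)
  hence "card S = card (residues M S)" by (simp add: card_image)
  also have "\<dots> \<le> p ^ (M - b)"
    using card_residues_le[of b M p S] S p_pos assms by (auto simp: congruent_def)
  finally have cardS: "real (card S) \<le> real p ^ (M - b)" by (metis of_nat_le_iff of_nat_power)
  have "cmod (F S w) ^ 6 \<le> (mass S * real p ^ (M - b)) ^ 3" if "w \<in> Omega" for w
  proof -
    have "(cmod (F S w))\<^sup>2 \<le> mass S * real p ^ (M - b)"
      using F_square_le[OF finS that] cardS mass_nonneg[of S] by (meson mult_left_mono order_trans)
    hence "((cmod (F S w))\<^sup>2) ^ 3 \<le> (mass S * real p ^ (M - b)) ^ 3" by (intro power_mono) auto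
    thus ?thesis by (simp flip: power_mult)
  qed
  hence "(\<Sum>w\<in>Omega. cmod (F S w) ^ 6) \<le> (\<Sum>w\<in>Omega. (mass S * real p ^ (M - b)) ^ 3)"
    by (intro sum_mono)
  also have "\<dots> = card Omega * real p ^ (3 * (M - b)) * mass S ^ 3"
    by (simp add: power_mult_distrib mult_ac flip: power_mult)
  finally show "(\<Sum>w\<in>Omega. cmod (F S w) ^ 6) \<le> card Omega * real p ^ (3 * (M - b)) * mass S ^ 3" .
qed

text \<open>Descending induction on \<open>b\<close>, each level costing \<open>r ^ 6\<close>.
  Passing to scale \<open>Suc b\<close> saves this factor, whence \<open>l1 = (1 / r)^2\<close>, and
  \<open>J\<close> exchanges save \<open>r ^ (3 * J)\<close>, whence
  \<open>l2 = (1 / r) ^ J\<close>. The exchanges need \<open>2 ^ J\<close> levels of room; closer to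
  \<open>M\<close> the trivial bound is used, at a cost absorbed by
  \<open>p ^ (3 * 2 ^ J)\<close>.\<close>

lemma moment_bound_power:
  assumes r: "1 \<le> r" and J: "(1 / r)\<^sup>2 + real p * (1 / r) ^ J \<le> 1" and b: "1 \<le> b" "b \<le> M"
  shows "moment_bound b (card Omega * real p ^ (3 * 2 ^ J) * r ^ (6 * (M - b)))"
  using b
proof (induction "M - b" arbitrary: b rule: less_induct)
  case less
  define c0 where "c0 = card Omega * real p ^ (3 * 2 ^ J)"
  have c0: "c0 \<ge> 0" by (simp add: c0_def)
  have r0: "r > 0" using r by simp
  have p1: "1 \<le> real p" using p_pos by simp
  show ?case
  proof (cases "M - b < 2 ^ J")
    case True
    have "real p ^ (3 * (M - b)) * 1 \<le> real p ^ (3 * 2 ^ J) * r ^ (6 * (M - b))"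
      by (intro mult_mono power_increasing one_le_power) (use True r p1 in auto)
    hence "card Omega * real p ^ (3 * (M - b)) \<le> c0 * r ^ (6 * (M - b))"
      unfolding c0_def mult.assoc by (intro mult_left_mono) auto
    thus ?thesis using moment_bound_mono moment_bound_trivial less.prems unfolding c0_def by blast
  next
    case False
    have one: "(1::nat) \<le> 2 ^ J" by simp
    have bM: "b < M" and bJ: "b + 2 ^ J \<le> M"
      using False one by linarith+
    define c where "c = c0 * r ^ (6 * (M - b))"
    have IH: "moment_bound b' (c0 * r ^ (6 * (M - b')))" if "b < b'" "b' \<le> M" for b'
      unfolding c0_def using less.hyps[of b'] that less.prems by auto
    have "mixed_bound b (b + 1) (b + 1) (c0 * r ^ (6 * (M - b)) / r ^ (3 * 1 * J))"
      by (rule mixed_bound_iterate[OF less.prems(1) c0 r IH]) (use bM bJ in auto)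
    hence 1: "mixed_bound b (Suc b) (Suc b) (c * ((1 / r) ^ J) ^ 3)"
      by (simp add: c_def power_divide mult.commute flip: power_mult)
    have "6 * (M - b) = 6 * (M - Suc b) + 6" using bM by simp
    hence "r ^ (6 * (M - b)) = r ^ (6 * (M - Suc b)) * r ^ 6" by (metis power_add)
    hence "c * ((1 / r)\<^sup>2) ^ 3 = c0 * r ^ (6 * (M - Suc b))"
      using r0 by (simp add: c_def power_divide flip: power_mult)
    hence 2: "moment_bound (Suc b) (c * ((1 / r)\<^sup>2) ^ 3)" using IH[of "Suc b"] bM by simp
    have "moment_bound b c"
      by (rule moment_bound_step[OF 2 1]) (use J c0 r0 in \<open>auto simp: c_def\<close>)
    thus ?thesis by (simp add: c_def c0_def)
  qed
qed

end

section \<open>The sixth moment on a grid\<close>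

definition grid_char :: "nat \<Rightarrow> int \<Rightarrow> int \<Rightarrow> nat \<times> nat \<Rightarrow> complex" where
  "grid_char Q \<alpha> \<beta> = (\<lambda>(i, j). cis (2 * pi * (of_int \<alpha> * real i + of_int \<beta> * real j) / real Q))"

lemma norm_grid_char [simp]: "cmod (grid_char Q \<alpha> \<beta> w) = 1"
  by (simp add: grid_char_def split: prod.split)

lemma grid_char_mult: "grid_char Q \<alpha> \<beta> w * grid_char Q \<gamma> \<delta> w = grid_char Q (\<alpha> + \<gamma>) (\<beta> + \<delta>) w"
  by (simp add: grid_char_def cis_mult algebra_simps add_divide_distrib split: prod.split)

lemma cnj_grid_char: "cnj (grid_char Q \<alpha> \<beta> w) = grid_char Q (- \<alpha>) (- \<beta>) w"
  by (simp add: grid_char_def cis_cnj minus_divide_left algebra_simps split: prod.split)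

lemma sum_roots_of_unity_nonzero:
  assumes "Q > 0" and nz: "(\<Sum>i<Q. cis (2 * pi * (of_int m * real i) / real Q)) \<noteq> 0"
  shows "int Q dvd m"
proof -
  define z where "z = cis (2 * pi * of_int m / real Q)"
  have "cis (2 * pi * (of_int m * real i) / real Q) = z ^ i" for i
    by (simp add: z_def Complex.DeMoivre mult_ac)
  hence nz': "(\<Sum>i<Q. z ^ i) \<noteq> 0" using nz by simp
  have "z ^ Q = cis (2 * pi * of_int m)"
    using assms(1) by (simp add: z_def Complex.DeMoivre)
  hence "z ^ Q = 1" by (simp add: cis_multiple_2pi)
  hence "z = 1" using nz' geometric_sum[of z Q] by auto
  then obtain n :: int where "2 * pi * of_int m / real Q = of_int (2 * n) * pi"
    unfolding z_def cis_conv_exp exp_eq_1 by auto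
  hence "real_of_int m = of_int (int Q * n)" using assms(1) by (simp add: field_simps)
  hence "m = int Q * n" by (simp only: of_int_eq_iff)
  thus ?thesis by simp
qed

lemma sum_grid_char_nonzero:
  assumes "Q > 0" and nz: "(\<Sum>w\<in>{..<Q} \<times> {..<Q}. grid_char Q \<alpha> \<beta> w) \<noteq> 0"
  shows "int Q dvd \<alpha> \<and> int Q dvd \<beta>"
proof -
  have "(\<Sum>w\<in>{..<Q} \<times> {..<Q}. grid_char Q \<alpha> \<beta> w)
     = (\<Sum>i<Q. cis (2 * pi * (of_int \<alpha> * real i) / real Q))
       * (\<Sum>j<Q. cis (2 * pi * (of_int \<beta> * real j) / real Q))"
    unfolding sum_product sum.cartesian_product
    by (rule sum.cong) (auto simp: grid_char_def cis_mult distrib_left add_divide_distrib)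
  thus ?thesis using assms sum_roots_of_unity_nonzero by auto
qed

text \<open>Dividing all frequencies by \<open>p ^ v\<close> leaves integers prime to
  \<open>p\<close> in a single class modulo \<open>p\<close>, so the scale 1 bound applies. The
  exponent of \<open>Q\<close> leaves room for the factor \<open>p ^ (v * k)\<close> that this puts
  in front of the \<open>k\<close>-th powers.\<close>

lemma grid_class_bound:
  fixes p k M v J :: nat and S :: "nat set" and a :: "nat \<Rightarrow> complex"
  assumes p: "prime p" "k < p" and k: "2 \<le> k"
    and r: "1 \<le> r" and J: "(1 / r)\<^sup>2 + real p * (1 / r) ^ J \<le> 1" and M: "1 \<le> M" "v \<le> M"
    and S: "finite S" "\<And>n. n \<in> S \<Longrightarrow> n < p ^ M"
      "\<And>n. n \<in> S \<Longrightarrow> \<exists>m. n = p ^ v * m \<and> m mod p = u" and u: "0 < u" "u < p"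
  defines "Q \<equiv> p ^ ((k + 2) * M)"
  shows "(\<Sum>w\<in>{..<Q} \<times> {..<Q}. cmod (\<Sum>n\<in>S. a n * grid_char Q (int n) (int n ^ k) w) ^ 6)
    \<le> (real Q)\<^sup>2 * real p ^ (3 * 2 ^ J) * r ^ (6 * (M - 1)) * (\<Sum>n\<in>S. (cmod (a n))\<^sup>2) ^ 3"
proof -
  have p0: "p > 0" using p by (simp add: prime_gt_0_nat)
  have Q0: "Q > 0" using p0 by (simp add: Q_def)
  define Omega where "Omega = {..<Q} \<times> {..<Q}"
  define h where "h n = int (n div p ^ v)" for n
  have nS: "n = p ^ v * (n div p ^ v)" "(n div p ^ v) mod p = u" if n: "n \<in> S" for n
    using S(3)[OF n] p0 by auto
  have injh: "inj_on h S" 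
    by (rule inj_onI) (metis nS(1) h_def of_nat_eq_iff)
  define X where "X = h ` S"
  define e where "e x = grid_char Q (int p ^ v * x) (int p ^ (v * k) * x ^ k)" for x
  define a' where "a' x = a (p ^ v * nat x)" for x
  have X: "0 \<le> x \<and> x < int p ^ M \<and> x mod int p = int u" if xX: "x \<in> X" for x
  proof -
    obtain n where n: "n \<in> S" "x = h n" using xX unfolding X_def by blast
    have "n div p ^ v < p ^ M" using S(2)[OF n(1)] div_le_dividend le_less_trans by blast
    thus ?thesis using nS[OF n(1)] n by (auto simp: h_def simp flip: of_nat_mod of_nat_power)
  qed
  interpret padic_system Omega e a' X p k M
  proof
    show "finite Omega" "finite X" using S by (auto simp: Omega_def X_def)
    show "prime p" "k < p" "2 \<le> k" by fact+
    show "cmod (e n w) = 1" for n w by (simp add: e_def)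
    show "\<not> int p dvd n" if "n \<in> X" for n
      using X[OF that] u by (auto simp: dvd_eq_mod_eq_0)
    show "x = y" if "x \<in> X" "y \<in> X" "int p ^ M dvd x - y" for x y
      using X[OF that(1)] X[OF that(2)] that(3) 
      by (metis mod_eq_dvd_iff[of x "int p ^ M" y] mod_pos_pos_trivial[of x] mod_pos_pos_trivial[of y])
    fix s s' t1 t2 t3 t4 :: int
    define \<alpha> where "\<alpha> = s - s' + t1 + t2 - t3 - t4"
    define \<beta> where "\<beta> = s ^ k - s' ^ k + t1 ^ k + t2 ^ k - t3 ^ k - t4 ^ k"
    assume "(\<Sum>w\<in>Omega. e s w * cnj (e s' w) * (e t1 w * e t2 w * cnj (e t3 w * e t4 w))) \<noteq> 0"
    moreover have "e s w * cnj (e s' w) * (e t1 w * e t2 w * cnj (e t3 w * e t4 w))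
        = grid_char Q (int p ^ v * \<alpha>) (int p ^ (v * k) * \<beta>) w" for w
      unfolding e_def complex_cnj_mult cnj_grid_char grid_char_mult \<alpha>_def \<beta>_def
      by (intro arg_cong2[where f = "\<lambda>x y. grid_char Q x y w"]) (simp_all add: algebra_simps)
    ultimately have d: "int Q dvd int p ^ v * \<alpha>" "int Q dvd int p ^ (v * k) * \<beta>"
      using sum_grid_char_nonzero[OF Q0] unfolding Omega_def by auto
    \<comment> \<open>Cancelling at most \<open>k * M\<close> powers of \<open>p\<close> from the
      \<open>(k + 2) * M\<close> in \<open>Q\<close> still leaves \<open>2 * M\<close>.\<close>
    have "int p ^ (2 * M) dvd y" if y: "int Q dvd int p ^ m * y" and m: "m \<le> k * M" for m y
    proof -
      have "int p ^ m * int p ^ (2 * M) dvd int Q"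
        unfolding Q_def of_nat_power power_add[symmetric]
        by (rule le_imp_power_dvd) (use m in \<open>simp add: algebra_simps\<close>)
      hence "int p ^ m * int p ^ (2 * M) dvd int p ^ m * y" using y dvd_trans by blast
      thus ?thesis using p0 by simp
    qed
    moreover have "v \<le> k * M" by (rule le_trans[OF M(2)]) (use k in simp)
    moreover have "v * k \<le> k * M" using M(2) by (simp add: mult.commute)
    ultimately have "int p ^ (2 * M) dvd \<alpha>" "int p ^ (2 * M) dvd \<beta>"
      using d by blast+
    thus "int p ^ (2 * M) dvd s - s' + t1 + t2 - t3 - t4
        \<and> int p ^ (2 * M) dvd s ^ k - s' ^ k + t1 ^ k + t2 ^ k - t3 ^ k - t4 ^ k"
      by (simp only: \<alpha>_def \<beta>_def simp_thms)
  qed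
  have "congruent 1 X" unfolding congruent_def using X by (simp add: mod_eq_dvd_iff[symmetric])
  hence "(\<Sum>w\<in>Omega. cmod (F X w) ^ 6)
      \<le> card Omega * real p ^ (3 * 2 ^ J) * r ^ (6 * (M - 1)) * mass X ^ 3"
    using moment_bound_power[OF r J, of 1] M unfolding moment_bound_def by blast
  moreover have "mass X = (\<Sum>n\<in>S. (cmod (a n))\<^sup>2)"
    unfolding mass_def X_def sum.reindex[OF injh] using nS by (simp add: a'_def h_def)
  moreover have "F X w = (\<Sum>n\<in>S. a n * grid_char Q (int n) (int n ^ k) w)" for w
    unfolding F_def X_def sum.reindex[OF injh] o_def
  proof (rule sum.cong[OF refl])
    fix n assume n: "n \<in> S"
    have "int p ^ v * h n = int n" unfolding h_def using nS(1)[OF n] by (metis of_nat_mult of_nat_power)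
    moreover from this have "int p ^ (v * k) * h n ^ k = int n ^ k"
      by (metis power_mult power_mult_distrib)
    moreover have "a' (h n) = a n" using nS(1)[OF n] by (simp add: a'_def h_def)
    ultimately show "a' (h n) * e (h n) w = a n * grid_char Q (int n) (int n ^ k) w"
      by (simp add: e_def)
  qed
  ultimately show ?thesis by (simp add: Omega_def power2_eq_square)
qed

text \<open>Frequencies are sorted by their \<open>p\<close>-adic valuation and first nonzero digit.
  There are at most \<open>p * (M + 1)\<close> such classes; Minkowski in \<open>L^6\<close>
  followed by Cauchy-Schwarz recombines them at the cost of the cube of that number.\<close>

lemma grid_sixth_moment_prime:
  fixes p k M N J :: nat and a :: "nat \<Rightarrow> complex"
  assumes p: "prime p" "k < p" and k: "2 \<le> k"
    and r: "1 \<le> r" and J: "(1 / r)\<^sup>2 + real p * (1 / r) ^ J \<le> 1" and M: "1 \<le> M" "N < p ^ M"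
  defines "Q \<equiv> p ^ ((k + 2) * M)"
  shows "(\<Sum>w\<in>{..<Q} \<times> {..<Q}. cmod (\<Sum>n=0..N. a n * grid_char Q (int n) (int n ^ k) w) ^ 6)
    \<le> (real Q)\<^sup>2 * real p ^ (3 * 2 ^ J) * r ^ (6 * M) * (real p * (real M + 1)) ^ 3
      * (\<Sum>n=0..N. (cmod (a n))\<^sup>2) ^ 3"
proof -
  have p1: "p > 1" using p by (simp add: prime_gt_Suc_0_nat)
  define Omega where "Omega = {..<Q} \<times> {..<Q}"
  \<comment> \<open>Zero has no first nonzero digit. Its label is not shared, since every other
    \<open>n\<close> in the range has valuation below \<open>M\<close>; its single term is estimated
    directly.\<close>
  define \<kappa> where "\<kappa> n = (if n = 0 then (M, 0)
     else (multiplicity p n, (n div p ^ multiplicity p n) mod p))" for n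
  define I where "I = \<kappa> ` {0..N}"
  define S where "S i = {n. n \<in> {0..N} \<and> \<kappa> n = i}" for i
  define \<mu> where "\<mu> i = (\<Sum>n\<in>S i. (cmod (a n))\<^sup>2)" for i
  define \<Phi> where "\<Phi> i w = (\<Sum>n\<in>S i. a n * grid_char Q (int n) (int n ^ k) w)" for i w
  define c where "c = (real Q)\<^sup>2 * real p ^ (3 * 2 ^ J) * r ^ (6 * M)"
  have c0: "c \<ge> 0" using r by (simp add: c_def)
  have c1: "c \<ge> (real Q)\<^sup>2"
  proof -
    have "(real Q)\<^sup>2 * (1 * 1) \<le> (real Q)\<^sup>2 * (real p ^ (3 * 2 ^ J) * r ^ (6 * M))"
      by (intro mult_left_mono mult_mono one_le_power) (use r p1 in auto)
    thus ?thesis by (simp add: c_def mult.assoc)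
  qed
  have mult_less: "multiplicity p n < M" if "n \<in> {0..N}" "n \<noteq> 0" for n
  proof -
    have "p ^ multiplicity p n \<le> n" using that by (intro dvd_imp_le multiplicity_dvd) auto
    hence "p ^ multiplicity p n < p ^ M" using that M by auto
    thus ?thesis using p1 by simp
  qed
  have \<mu>0: "\<mu> i \<ge> 0" for i by (simp add: \<mu>_def sum_nonneg)
  have cls: "(\<Sum>w\<in>Omega. cmod (\<Phi> i w) ^ 6) \<le> c * \<mu> i ^ 3" if i: "i \<in> I" for i
  proof (cases "i = (M, 0)")
    case True
    have "\<kappa> n \<noteq> i" if "n \<in> {0..N}" "n \<noteq> 0" for n
      using mult_less[OF that] that True by (simp add: \<kappa>_def)
    hence "S i \<subseteq> {0}" unfolding S_def by blast
    moreover have "0 \<in> S i" using True by (simp add: S_def \<kappa>_def)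
    ultimately have "S i = {0}" by blast
    moreover have six: "x ^ 6 = (x\<^sup>2) ^ 3" for x :: real by (simp flip: power_mult)
    ultimately have "(\<Sum>w\<in>Omega. cmod (\<Phi> i w) ^ 6) = (real Q)\<^sup>2 * \<mu> i ^ 3"
      by (simp add: \<Phi>_def \<mu>_def Omega_def norm_mult six power2_eq_square)
    also have "\<dots> \<le> c * \<mu> i ^ 3" by (intro mult_right_mono c1) (simp add: \<mu>0)
    finally show ?thesis .
  next
    case False
    obtain v u where vu: "i = (v, u)" by (cases i)
    from i obtain n0 where n0: "n0 \<in> {0..N}" "\<kappa> n0 = i" by (auto simp: I_def)
    have n00: "n0 \<noteq> 0"
    proof
      assume "n0 = 0"
      with n0(2) have "i = (M, 0)" by (simp add: \<kappa>_def)
      with False show False by simp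
    qed
    have u: "u = (n0 div p ^ multiplicity p n0) mod p" and v: "v = multiplicity p n0"
      using n0 n00 vu by (auto simp: \<kappa>_def)
    have "u \<noteq> 0"
    proof
      assume "u = 0"
      hence "p dvd n0 div p ^ multiplicity p n0" using u by auto
      thus False using n00 p1 multiplicity_decompose[of n0 p] by auto
    qed
    hence u': "0 < u" "u < p" using p1 by (auto simp: u)
    have Sn: "\<exists>m. n = p ^ v * m \<and> m mod p = u" if "n \<in> S i" for n
    proof (cases "n = 0")
      case True
      thus ?thesis using that False by (auto simp: S_def \<kappa>_def)
    next
      case n: False
      hence "v = multiplicity p n" "u = (n div p ^ multiplicity p n) mod p"
        using that vu by (auto simp: S_def \<kappa>_def)
      thus ?thesis by (intro exI[of _ "n div p ^ v"]) (simp add: multiplicity_dvd)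
    qed
    have "(\<Sum>w\<in>Omega. cmod (\<Phi> i w) ^ 6)
      \<le> (real Q)\<^sup>2 * real p ^ (3 * 2 ^ J) * r ^ (6 * (M - 1)) * \<mu> i ^ 3"
      unfolding Omega_def \<Phi>_def \<mu>_def Q_def
    proof (rule grid_class_bound[OF p k r J M(1) _ _ _ Sn u'])
      show "v \<le> M" using mult_less[OF n0(1) n00] by (simp add: v)
      show "n < p ^ M" if "n \<in> S i" for n using that M by (auto simp: S_def)
    qed (auto simp: S_def)
    also have "\<dots> \<le> c * \<mu> i ^ 3"
      unfolding c_def by (intro mult_right_mono mult_left_mono power_increasing) (use r \<mu>0 in auto)
    finally show ?thesis .
  qed
  have finI: "finite I" by (simp add: I_def)
  have "I \<subseteq> {..M} \<times> {..<p}"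
    using mult_less p1 by (fastforce simp: I_def \<kappa>_def intro: less_imp_le)
  hence "card I \<le> card ({..M} \<times> {..<p})" by (intro card_mono) auto
  hence cardI: "real (card I) \<le> real p * (real M + 1)"
    by (simp add: card_cartesian_product algebra_simps flip: of_nat_mult of_nat_Suc of_nat_add)
  have mass: "(\<Sum>i\<in>I. \<mu> i) = (\<Sum>n=0..N. (cmod (a n))\<^sup>2)"
    unfolding \<mu>_def S_def I_def by (rule sum.image_gen[symmetric]) simp
  have "(\<Sum>w\<in>Omega. cmod (\<Sum>n=0..N. a n * grid_char Q (int n) (int n ^ k) w) ^ 6)
     \<le> (\<Sum>w\<in>Omega. (\<Sum>i\<in>I. cmod (\<Phi> i w)) ^ Suc 5)"
  proof (rule sum_mono)
    fix w
    have "(\<Sum>n=0..N. a n * grid_char Q (int n) (int n ^ k) w) = (\<Sum>i\<in>I. \<Phi> i w)"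
      unfolding \<Phi>_def S_def I_def by (rule sum.image_gen) simp
    hence "cmod (\<Sum>n=0..N. a n * grid_char Q (int n) (int n ^ k) w) \<le> (\<Sum>i\<in>I. cmod (\<Phi> i w))"
      by (simp add: norm_sum)
    from power_mono[OF this norm_ge_zero, of 6]
    show "cmod (\<Sum>n=0..N. a n * grid_char Q (int n) (int n ^ k) w) ^ 6 \<le> (\<Sum>i\<in>I. cmod (\<Phi> i w)) ^ Suc 5"
      by simp
  qed
  also have "\<dots> \<le> c * (\<Sum>i\<in>I. sqrt (\<mu> i)) ^ Suc 5"
  proof (rule Minkowski_finite_sum)
    fix i assume "i \<in> I"
    have "sqrt (\<mu> i) ^ 6 = ((sqrt (\<mu> i))\<^sup>2) ^ 3" by (simp flip: power_mult)
    hence "sqrt (\<mu> i) ^ Suc 5 = \<mu> i ^ 3" using \<mu>0 by simp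
    thus "(\<Sum>w\<in>Omega. cmod (\<Phi> i w) ^ Suc 5) \<le> c * sqrt (\<mu> i) ^ Suc 5"
      using cls[OF \<open>i \<in> I\<close>] by simp
  qed (use finI c0 \<mu>0 in \<open>auto simp: Omega_def\<close>)
  also have "(\<Sum>i\<in>I. sqrt (\<mu> i)) ^ Suc 5 = ((\<Sum>i\<in>I. sqrt (\<mu> i))\<^sup>2) ^ 3"
    by (simp flip: power_mult)
  also have "c * \<dots> \<le> c * ((\<Sum>i\<in>I. (sqrt (\<mu> i))\<^sup>2) * card I) ^ 3"
    by (intro mult_left_mono power_mono sum_squared_le_sum_of_squares c0) simp
  also have "\<dots> = c * ((\<Sum>n=0..N. (cmod (a n))\<^sup>2) * card I) ^ 3"
    using \<mu>0 by (simp add: mass)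
  also have "\<dots> \<le> c * ((\<Sum>n=0..N. (cmod (a n))\<^sup>2) * (real p * (real M + 1))) ^ 3"
    by (intro mult_left_mono power_mono cardI c0) (auto intro!: sum_nonneg mult_nonneg_nonneg)
  finally show ?thesis by (simp add: c_def Omega_def power_mult_distrib mult_ac)
qed

text \<open>\<open>Q\<close> depends on \<open>N\<close> but not on \<open>a\<close>, so that one
  grid serves all the coefficient sequences arising later from the Taylor expansion.\<close>

lemma grid_sixth_moment:
  fixes k :: nat and \<epsilon> :: real
  assumes k: "2 \<le> k" and \<epsilon>: "\<epsilon> > 0"
  shows "\<exists>K>0. \<forall>N\<ge>1. \<exists>Q>0. \<forall>a :: nat \<Rightarrow> complex.
    (\<Sum>w\<in>{..<Q} \<times> {..<Q}. cmod (\<Sum>n=0..N. a n * grid_char Q (int n) (int n ^ k) w) ^ 6)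
    \<le> K * real N powr \<epsilon> * (real Q)\<^sup>2 * (\<Sum>n=0..N. (cmod (a n))\<^sup>2) ^ 3"
proof -
  obtain p where p: "prime p" "k < p" using bigger_prime by blast
  have p1: "p > 1" using p by (simp add: prime_gt_Suc_0_nat)
  \<comment> \<open>The 9 is 6 + 3: \<open>r ^ (6 * M)\<close> comes from the scales and
    \<open>(r ^ M) ^ 3\<close> from bounding \<open>(M + 1) ^ 3\<close>. As \<open>M\<close> is
    chosen minimal, \<open>p ^ M\<close> is at most \<open>p * N\<close>.\<close>
  define r where "r = real p powr (\<epsilon> / 9)"
  have r1: "r > 1" using p1 \<epsilon> by (simp add: r_def)
  have "(\<lambda>J. (1 / r)\<^sup>2 + real p * (1 / r) ^ J) \<longlonglongrightarrow> (1 / r)\<^sup>2 + real p * 0"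
    by (intro tendsto_intros LIMSEQ_power_zero) (use r1 in auto)
  moreover have "(1 / r)\<^sup>2 + real p * 0 < 1" using r1 by (simp add: power_less_one_iff)
  ultimately have "\<forall>\<^sub>F J in sequentially. (1 / r)\<^sup>2 + real p * (1 / r) ^ J < 1"
    by (rule order_tendstoD(2))
  then obtain J where J: "(1 / r)\<^sup>2 + real p * (1 / r) ^ J \<le> 1"
    by (auto simp: eventually_sequentially intro: less_imp_le)
  define A where "A = 1 + 1 / (r - 1)"
  have A0: "A > 0" using r1 by (simp add: A_def add_pos_pos)
  have MA: "real M + 1 \<le> A * r ^ M" for M
  proof -
    have "1 + real M * (r - 1) \<le> r ^ M"
      using Bernoulli_inequality[of "r - 1" M] r1 by simp
    hence "real M * (r - 1) \<le> r ^ M" by simp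
    hence "real M \<le> r ^ M / (r - 1)" using r1 by (simp add: field_simps)
    moreover have "1 \<le> r ^ M" using r1 by simp
    ultimately show ?thesis by (simp add: A_def algebra_simps)
  qed
  define K where "K = real p ^ (3 * 2 ^ J) * (real p * A) ^ 3 * real p powr \<epsilon>"
  show ?thesis
  proof (intro exI[of _ K] conjI allI impI)
    show "K > 0" using p1 A0 by (simp add: K_def)
    fix N :: nat assume N: "N \<ge> 1"
    have "\<exists>M. N < p ^ M" using p1 power_gt_expt[of p N] by auto
    define M where "M = (LEAST M. N < p ^ M)"
    have NM: "N < p ^ M" unfolding M_def by (rule LeastI_ex) fact
    have M1: "1 \<le> M" using NM N by (cases M) auto
    have "\<not> N < p ^ (M - 1)" unfolding M_def by (rule not_less_Least) (use M1 M_def in simp)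
    hence "real p ^ (M - 1) \<le> real N" by (simp flip: of_nat_power)
    hence "real p ^ M \<le> real p * real N"
      using M1 by (metis le_add_diff_inverse mult_left_mono of_nat_0_le_iff plus_1_eq_Suc power_Suc)
    hence "(real p ^ M) powr \<epsilon> \<le> (real p * real N) powr \<epsilon>"
      using \<epsilon> by (intro powr_mono2) auto
    moreover have "r ^ (9 * M) = (real p ^ M) powr \<epsilon>"
      using p1 by (simp add: r_def powr_powr mult.commute flip: powr_realpow)
    ultimately have rN: "r ^ (9 * M) \<le> real p powr \<epsilon> * real N powr \<epsilon>" by (simp add: powr_mult)
    define Q where "Q = p ^ ((k + 2) * M)"
    show "\<exists>Q>0. \<forall>a :: nat \<Rightarrow> complex.
      (\<Sum>w\<in>{..<Q} \<times> {..<Q}. cmod (\<Sum>n=0..N. a n * grid_char Q (int n) (int n ^ k) w) ^ 6)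
      \<le> K * real N powr \<epsilon> * (real Q)\<^sup>2 * (\<Sum>n=0..N. (cmod (a n))\<^sup>2) ^ 3"
    proof (intro exI[of _ Q] conjI allI)
      show "Q > 0" using p1 by (simp add: Q_def)
      fix a :: "nat \<Rightarrow> complex"
      define m where "m = (\<Sum>n=0..N. (cmod (a n))\<^sup>2)"
      have r9: "r ^ (9 * M) = r ^ (6 * M) * (r ^ M) ^ 3" by (simp flip: power_mult power_add)
      have m0: "m \<ge> 0" by (simp add: m_def sum_nonneg)
      have "(\<Sum>w\<in>{..<Q} \<times> {..<Q}. cmod (\<Sum>n=0..N. a n * grid_char Q (int n) (int n ^ k) w) ^ 6)
         \<le> (real Q)\<^sup>2 * real p ^ (3 * 2 ^ J) * r ^ (6 * M) * (real p * (real M + 1)) ^ 3 * m ^ 3"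
        unfolding Q_def m_def
        by (rule grid_sixth_moment_prime[OF p k _ J M1 NM]) (use r1 in simp)
      also have "\<dots> \<le> (real Q)\<^sup>2 * real p ^ (3 * 2 ^ J) * r ^ (6 * M) * (real p * (A * r ^ M)) ^ 3 * m ^ 3"
        by (intro mult_right_mono mult_left_mono power_mono MA) (use m0 r1 in auto)
      also have "\<dots> = (real Q)\<^sup>2 * real p ^ (3 * 2 ^ J) * (real p * A) ^ 3 * m ^ 3 * r ^ (9 * M)"
        unfolding r9 by (simp add: power_mult_distrib mult_ac)
      also have "\<dots> \<le> (real Q)\<^sup>2 * real p ^ (3 * 2 ^ J) * (real p * A) ^ 3 * m ^ 3
          * (real p powr \<epsilon> * real N powr \<epsilon>)"
        by (intro mult_left_mono rN) (use m0 A0 in auto)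
      also have "\<dots> = K * real N powr \<epsilon> * (real Q)\<^sup>2 * m ^ 3"
        by (simp add: K_def mult_ac)
      finally show "(\<Sum>w\<in>{..<Q} \<times> {..<Q}. cmod (\<Sum>n=0..N. a n * grid_char Q (int n) (int n ^ k) w) ^ 6)
         \<le> K * real N powr \<epsilon> * (real Q)\<^sup>2 * (\<Sum>n=0..N. (cmod (a n))\<^sup>2) ^ 3"
        unfolding m_def .
    qed
  qed
qed

section \<open>From the grid to the unit square\<close>

definition perturbed_Weyl_sum ::
  "nat \<Rightarrow> (nat \<Rightarrow> real) \<Rightarrow> nat \<Rightarrow> (nat \<Rightarrow> complex) \<Rightarrow> real \<times> real \<Rightarrow> complex" where
  "perturbed_Weyl_sum k \<theta> N a = (\<lambda>(x, t). \<Sum>n=0..N. a n *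
      exp (2 * of_real pi * \<i> * of_real (real n * x + (real n ^ k + \<theta> n) * t)))"

lemma exp_2pi_i_eq_cis: "exp (2 * of_real pi * \<i> * of_real y) = cis (2 * pi * y)"
  by (simp add: cis_conv_exp mult_ac)

lemma norm_perturbed_Weyl_sum_square_le:
  "(cmod (perturbed_Weyl_sum k \<theta> N a z))\<^sup>2 \<le> (\<Sum>n=0..N. (cmod (a n))\<^sup>2) * (real N + 1)"
proof -
  obtain x t where z: "z = (x, t)" by (cases z)
  have "cmod (perturbed_Weyl_sum k \<theta> N a z) \<le> (\<Sum>n=0..N. cmod (a n))"
    unfolding perturbed_Weyl_sum_def z prod.case exp_2pi_i_eq_cis
    by (intro sum_norm_le) (simp add: norm_mult)
  hence "(cmod (perturbed_Weyl_sum k \<theta> N a z))\<^sup>2 \<le> (\<Sum>n=0..N. cmod (a n))\<^sup>2"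
    by (intro power_mono) auto
  also have "\<dots> \<le> (\<Sum>n=0..N. (cmod (a n))\<^sup>2) * card {0..N}"
    by (rule sum_squared_le_sum_of_squares)
  finally show ?thesis by (simp add: add.commute)
qed

text \<open>Expanding the bounded phases \<open>\<theta>\<^sub>n t\<close> into a Taylor series in \<open>t\<close> replaces the coefficients \<open>a\<^sub>n\<close>
  by \<open>a\<^sub>n \<theta>\<^sub>n\<^sup>l\<close>, and the translation of the grid only changes the arguments of the coefficients.\<close>

lemma translated_grid_sixth_moment:
  fixes N k Q :: nat and a :: "nat \<Rightarrow> complex" and \<theta> :: "nat \<Rightarrow> real"
  assumes Q: "Q > 0" and B: "B \<ge> 0"
    and grid: "\<And>a :: nat \<Rightarrow> complex.
      (\<Sum>w\<in>{..<Q} \<times> {..<Q}. cmod (\<Sum>n=0..N. a n * grid_char Q (int n) (int n ^ k) w) ^ 6)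
      \<le> B * (\<Sum>n=0..N. (cmod (a n))\<^sup>2) ^ 3"
    and \<theta>: "\<And>n. n \<le> N \<Longrightarrow> \<bar>\<theta> n\<bar> \<le> C" and t: "0 \<le> t" "t \<le> 1 / real Q"
  shows "(\<Sum>(i, j)\<in>{..<Q} \<times> {..<Q}.
      cmod (perturbed_Weyl_sum k \<theta> N a (x + real i / real Q, t + real j / real Q)) ^ 6)
    \<le> B * exp (2 * pi * C) ^ 6 * (\<Sum>n=0..N. (cmod (a n))\<^sup>2) ^ 3"
proof -
  define \<Omega> where "\<Omega> = {..<Q} \<times> {..<Q}"
  define m where "m = (\<Sum>n=0..N. (cmod (a n))\<^sup>2)"
  have m0: "m \<ge> 0" by (simp add: m_def sum_nonneg)
  have C0: "C \<ge> 0" using \<theta>[of 0] by simp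
  \<comment> \<open>\<open>b n\<close> absorbs the unperturbed phase of the translation by
    \<open>(x, t)\<close>; the phase of \<open>\<theta> n\<close> keeps the full second coordinate
    \<open>\<tau> w\<close> and is the one to be expanded.\<close>
  define b where "b n = a n * cis (2 * pi * (real n * x + real n ^ k * t))" for n
  define \<psi> where "\<psi> n w = grid_char Q (int n) (int n ^ k) w" for n w
  define \<tau> where "\<tau> w = t + real (snd w) / real Q" for w :: "nat \<times> nat"
  define f where "f w = perturbed_Weyl_sum k \<theta> N a (x + real (fst w) / real Q, \<tau> w)" for w :: "nat \<times> nat"
  define G where "G l w = (\<Sum>n=0..N. b n * of_real (\<theta> n) ^ l * \<psi> n w)" for l w
  define P where "P L w = (\<Sum>l<L. (\<i> * of_real (2 * pi * \<tau> w)) ^ l / fact l * G l w)" for L w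
  have \<tau>: "0 \<le> \<tau> w" "\<tau> w \<le> 1" if w: "w \<in> \<Omega>" for w
  proof -
    show "0 \<le> \<tau> w" using t by (simp add: \<tau>_def)
    have "real (snd w) + 1 \<le> real Q" using w by (auto simp: \<Omega>_def)
    hence "(real (snd w) + 1) / real Q \<le> 1" using Q by (simp add: divide_le_eq)
    thus "\<tau> w \<le> 1" using t by (simp add: \<tau>_def add_divide_distrib)
  qed
  have f: "f w = (\<Sum>n=0..N. b n * \<psi> n w * exp (\<i> * of_real (2 * pi * \<theta> n * \<tau> w)))" for w
    unfolding f_def perturbed_Weyl_sum_def prod.case
  proof (rule sum.cong[OF refl])
    fix n
    obtain i j where w: "w = (i, j)" by (cases w)
    have "2 * pi * (real n * (x + real i / real Q) + (real n ^ k + \<theta> n) * \<tau> w)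
        = 2 * pi * (real n * x + real n ^ k * t)
          + 2 * pi * (real n * real i + real n ^ k * real j) / real Q + 2 * pi * \<theta> n * \<tau> w"
      using Q by (simp add: \<tau>_def w field_simps)
    thus "a n * exp (2 * of_real pi * \<i> * of_real (real n * (x + real (fst w) / real Q)
        + (real n ^ k + \<theta> n) * \<tau> w)) = b n * \<psi> n w * exp (\<i> * of_real (2 * pi * \<theta> n * \<tau> w))"
      unfolding exp_2pi_i_eq_cis cis_conv_exp[symmetric]
      by (simp add: b_def \<psi>_def grid_char_def w cis_mult mult.assoc)
  qed
  have P: "P L w = (\<Sum>n=0..N. b n * \<psi> n w *
      (\<Sum>l<L. (\<i> * of_real (2 * pi * \<theta> n * \<tau> w)) ^ l /\<^sub>R fact l))" for L w
    unfolding P_def G_def sum_distrib_left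
    by (subst sum.swap, intro sum.cong refl)
      (simp add: power_mult_distrib scaleR_conv_of_real field_simps)
  have lim: "(\<lambda>L. P L w) \<longlonglongrightarrow> f w" for w
    unfolding P f using exp_converges unfolding sums_def by (intro tendsto_intros) blast
  have bound: "(\<Sum>w\<in>\<Omega>. cmod (P L w) ^ 6) \<le> B * exp (2 * pi * C) ^ 6 * m ^ 3" for L
  proof -
    \<comment> \<open>Up to the constant \<open>B\<close>, this bounds the \<open>L^6\<close> norm
      of the term of order \<open>i\<close>. The sum over \<open>i\<close> stays below
      \<open>exp (2 * pi * C) * sqrt m\<close> for every truncation \<open>L\<close>, so the bound
      passes to the limit.\<close>
    define l where "l i = (2 * pi * C) ^ i / fact i * sqrt m" for i :: nat
    have sixth: "sqrt m ^ 6 = m ^ 3"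
    proof -
      have "sqrt m ^ 6 = ((sqrt m)\<^sup>2) ^ 3" by (simp flip: power_mult)
      thus ?thesis using m0 by simp
    qed
    have "(\<Sum>w\<in>\<Omega>. cmod (P L w) ^ 6)
        \<le> (\<Sum>w\<in>\<Omega>. (\<Sum>i<L. (2 * pi) ^ i / fact i * cmod (G i w)) ^ Suc 5)"
    proof (rule sum_mono)
      fix w assume w: "w \<in> \<Omega>"
      have "cmod (P L w) \<le> (\<Sum>i<L. (2 * pi) ^ i / fact i * cmod (G i w))"
        unfolding P_def
      proof (rule sum_norm_le)
        fix i
        have "(2 * pi * \<tau> w) ^ i \<le> (2 * pi * 1) ^ i"
          using \<tau>[OF w] by (intro power_mono mult_left_mono) auto
        hence "(2 * pi * \<tau> w) ^ i / fact i * cmod (G i w) \<le> (2 * pi) ^ i / fact i * cmod (G i w)"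
          by (intro mult_right_mono divide_right_mono) auto
        thus "cmod ((\<i> * of_real (2 * pi * \<tau> w)) ^ i / fact i * G i w)
            \<le> (2 * pi) ^ i / fact i * cmod (G i w)"
          using \<tau>[OF w] by (simp add: norm_mult norm_divide norm_power)
      qed
      from power_mono[OF this norm_ge_zero, of 6]
      show "cmod (P L w) ^ 6 \<le> (\<Sum>i<L. (2 * pi) ^ i / fact i * cmod (G i w)) ^ Suc 5"
        by simp
    qed
    also have "\<dots> \<le> B * (\<Sum>i<L. l i) ^ Suc 5"
    proof (rule Minkowski_finite_sum)
      fix i
      show "l i \<ge> 0" using C0 m0 by (simp add: l_def)
      have "(\<Sum>n=0..N. (cmod (b n * of_real (\<theta> n) ^ i))\<^sup>2) \<le> (\<Sum>n=0..N. (C ^ i)\<^sup>2 * (cmod (a n))\<^sup>2)"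
      proof (rule sum_mono)
        fix n assume n: "n \<in> {0..N}"
        have "\<bar>\<theta> n\<bar> \<le> C" using \<theta> n by simp
        hence "(\<bar>\<theta> n\<bar> ^ i * cmod (a n))\<^sup>2 \<le> (C ^ i * cmod (a n))\<^sup>2"
          by (intro power_mono mult_right_mono) auto
        moreover have "cmod (b n * of_real (\<theta> n) ^ i) = \<bar>\<theta> n\<bar> ^ i * cmod (a n)"
          by (simp add: b_def norm_mult norm_power)
        ultimately show "(cmod (b n * of_real (\<theta> n) ^ i))\<^sup>2 \<le> (C ^ i)\<^sup>2 * (cmod (a n))\<^sup>2"
          by (simp only: power_mult_distrib)
      qed
      also have "\<dots> = (C ^ i)\<^sup>2 * m" by (simp add: m_def sum_distrib_left)
      finally have "(\<Sum>n=0..N. (cmod (b n * of_real (\<theta> n) ^ i))\<^sup>2) ^ 3 \<le> ((C ^ i)\<^sup>2 * m) ^ 3"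
        by (intro power_mono) (auto intro: sum_nonneg)
      hence "B * (\<Sum>n=0..N. (cmod (b n * of_real (\<theta> n) ^ i))\<^sup>2) ^ 3 \<le> B * ((C ^ i)\<^sup>2 * m) ^ 3"
        by (intro mult_left_mono B)
      moreover have "(\<Sum>w\<in>\<Omega>. cmod (G i w) ^ 6)
          \<le> B * (\<Sum>n=0..N. (cmod (b n * of_real (\<theta> n) ^ i))\<^sup>2) ^ 3"
        unfolding G_def \<psi>_def \<Omega>_def by (rule grid)
      ultimately have "(\<Sum>w\<in>\<Omega>. cmod (G i w) ^ 6) \<le> B * ((C ^ i)\<^sup>2 * m) ^ 3" by linarith
      hence "((2 * pi) ^ i / fact i) ^ 6 * (\<Sum>w\<in>\<Omega>. cmod (G i w) ^ 6)
          \<le> ((2 * pi) ^ i / fact i) ^ 6 * (B * ((C ^ i)\<^sup>2 * m) ^ 3)"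
        by (intro mult_left_mono) auto
      also have "\<dots> = B * (((2 * pi) ^ i / fact i * C ^ i) ^ 6 * m ^ 3)"
      proof -
        have "((C ^ i)\<^sup>2 * m) ^ 3 = (C ^ i) ^ 6 * m ^ 3"
          unfolding power_mult_distrib by (simp add: mult.commute flip: power_mult)
        thus ?thesis unfolding power_mult_distrib[of _ "C ^ i"] by (simp only: mult_ac)
      qed
      also have "\<dots> = B * l i ^ 6"
        unfolding l_def power_mult_distrib[of _ "sqrt m"] sixth by (simp add: power_mult_distrib)
      finally have *: "((2 * pi) ^ i / fact i) ^ 6 * (\<Sum>w\<in>\<Omega>. cmod (G i w) ^ 6) \<le> B * l i ^ 6" .
      have "Suc 5 = 6" by simp
      show "(\<Sum>w\<in>\<Omega>. ((2 * pi) ^ i / fact i * cmod (G i w)) ^ Suc 5) \<le> B * l i ^ Suc 5"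
        unfolding \<open>Suc 5 = 6\<close> power_mult_distrib[of "(2 * pi) ^ i / fact i"] sum_distrib_left[symmetric] by (fact *)
    qed (auto simp: \<Omega>_def B)
    also have "\<dots> \<le> B * (exp (2 * pi * C) * sqrt m) ^ Suc 5"
    proof (intro mult_left_mono power_mono B)
      have "(\<Sum>i<L. (2 * pi * C) ^ i /\<^sub>R fact i) \<le> exp (2 * pi * C)"
        unfolding exp_def by (rule sum_le_suminf[OF summable_exp_generic]) (use C0 in auto)
      hence "(\<Sum>i<L. (2 * pi * C) ^ i /\<^sub>R fact i) * sqrt m \<le> exp (2 * pi * C) * sqrt m"
        by (intro mult_right_mono) (simp_all add: m0)
      thus "(\<Sum>i<L. l i) \<le> exp (2 * pi * C) * sqrt m"
        by (simp add: l_def sum_distrib_left sum_distrib_right divide_inverse mult.commute)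
      show "0 \<le> (\<Sum>i<L. l i)" using C0 m0 by (intro sum_nonneg) (simp add: l_def)
    qed
    also have "\<dots> = B * exp (2 * pi * C) ^ 6 * m ^ 3"
      using sixth by (simp add: power_mult_distrib)
    finally show ?thesis .
  qed
  have "(\<Sum>w\<in>\<Omega>. cmod (f w) ^ 6) \<le> B * exp (2 * pi * C) ^ 6 * m ^ 3"
    by (rule LIMSEQ_le_const2[where X = "\<lambda>L. \<Sum>w\<in>\<Omega>. cmod (P L w) ^ 6"])
      (use bound in \<open>auto intro!: tendsto_intros lim\<close>)
  thus ?thesis by (simp add: f_def \<tau>_def \<Omega>_def m_def split_def)
qed

text \<open>Translates of the square \<open>E\<close> of side \<open>1 / Q\<close> cover the unit
  square, and translation invariance moves every integral back to \<open>E\<close>, where the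
  hypothesis applies pointwise. Overlapping edges only enlarge the upper bound.\<close>

lemma nn_integral_unit_square_le:
  fixes g :: "real \<times> real \<Rightarrow> ennreal"
  assumes [measurable]: "g \<in> borel_measurable borel" and Q: "Q > 0"
    and V: "\<And>x t. 0 \<le> x \<Longrightarrow> x \<le> 1 / real Q \<Longrightarrow> 0 \<le> t \<Longrightarrow> t \<le> 1 / real Q
      \<Longrightarrow> (\<Sum>(i, j)\<in>{..<Q} \<times> {..<Q}. g (x + real i / real Q, t + real j / real Q)) \<le> V"
  shows "(\<integral>\<^sup>+z. g z * indicator ({0..1} \<times> {0..1}) z \<partial>lborel) \<le> V * ennreal (1 / (real Q)\<^sup>2)"
proof -
  define \<Omega> where "\<Omega> = {..<Q} \<times> {..<Q}"
  define c where "c = (\<lambda>(i, j). (real i / real Q, real j / real Q))"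
  define E where "E = cbox (0::real, 0::real) (1 / real Q, 1 / real Q)"
  have E: "z \<in> E \<longleftrightarrow> 0 \<le> fst z \<and> fst z \<le> 1 / real Q \<and> 0 \<le> snd z \<and> snd z \<le> 1 / real Q" for z
    unfolding E_def cbox_Pair_eq by (cases z) auto
  have [measurable]: "E \<in> sets borel" by (simp add: E_def)
  have cover: "\<exists>i<Q. real i / real Q \<le> x \<and> x \<le> real i / real Q + 1 / real Q" if x: "0 \<le> x" "x \<le> 1" for x
  \<comment> \<open>At the right end point the floor would give \<open>i = Q\<close>, so the last
    interval is named explicitly.\<close>
  proof (cases "x = 1")
    case True
    thus ?thesis using Q by (intro exI[of _ "Q - 1"]) (simp add: of_nat_diff diff_divide_distrib)
  next
    case False
    define i where "i = nat \<lfloor>x * real Q\<rfloor>"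
    have "real i \<le> x * real Q" "x * real Q < real i + 1"
      using x Q by (auto simp: i_def)
    moreover from this(1) have "i < Q" using False x Q
      by (metis le_less_trans mult_less_cancel_right2 not_le of_nat_0_less_iff of_nat_less_iff antisym)
    ultimately show ?thesis using Q
      by (intro exI[of _ i]) (auto simp: field_simps)
  qed
  have ind: "indicator ({0..1} \<times> {0..1}) z \<le> (\<Sum>w\<in>\<Omega>. indicator E (z - c w) :: ennreal)" for z
  proof (cases "z \<in> {0..1} \<times> {0..1}")
    case True
    then obtain i j where ij: "i < Q" "j < Q" "real i / real Q \<le> fst z" "fst z \<le> real i / real Q + 1 / real Q"
      "real j / real Q \<le> snd z" "snd z \<le> real j / real Q + 1 / real Q"
      using cover[of "fst z"] cover[of "snd z"] by auto
    hence "z - c (i, j) \<in> E" by (auto simp: E c_def)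
    hence "1 = (indicator E (z - c (i, j)) :: ennreal)" by simp
    also have "\<dots> \<le> (\<Sum>w\<in>\<Omega>. indicator E (z - c w))"
      by (rule member_le_sum) (use ij in \<open>auto simp: \<Omega>_def\<close>)
    finally show ?thesis using True by simp
  qed simp
  have "(\<integral>\<^sup>+z. g z * indicator ({0..1} \<times> {0..1}) z \<partial>lborel)
      \<le> (\<integral>\<^sup>+z. (\<Sum>w\<in>\<Omega>. g z * indicator E (z - c w)) \<partial>lborel)"
    unfolding sum_distrib_left[symmetric] by (intro nn_integral_mono mult_left_mono ind) simp
  also have "\<dots> = (\<Sum>w\<in>\<Omega>. \<integral>\<^sup>+z. g z * indicator E (z - c w) \<partial>lborel)"
    by (rule nn_integral_sum) simp
  also have "\<dots> = (\<Sum>w\<in>\<Omega>. \<integral>\<^sup>+z. g (c w + z) * indicator E z \<partial>lborel)"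
  proof (rule sum.cong[OF refl])
    fix w
    have "(\<integral>\<^sup>+z. g z * indicator E (z - c w) \<partial>lborel)
        = (\<integral>\<^sup>+z. g z * indicator E (z - c w) \<partial>(distr lborel borel ((+) (c w))))"
      by (simp only: lborel_distr_plus)
    also have "\<dots> = (\<integral>\<^sup>+z. g (c w + z) * indicator E z \<partial>lborel)"
      by (subst nn_integral_distr) auto
    finally show "(\<integral>\<^sup>+z. g z * indicator E (z - c w) \<partial>lborel)
        = (\<integral>\<^sup>+z. g (c w + z) * indicator E z \<partial>lborel)" .
  qed
  also have "\<dots> = (\<integral>\<^sup>+z. (\<Sum>w\<in>\<Omega>. g (c w + z) * indicator E z) \<partial>lborel)"
    by (rule nn_integral_sum[symmetric]) simp
  also have "\<dots> \<le> (\<integral>\<^sup>+z. V * indicator E z \<partial>lborel)"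
  proof (rule nn_integral_mono)
    fix z
    show "(\<Sum>w\<in>\<Omega>. g (c w + z) * indicator E z) \<le> V * indicator E z"
    proof (cases "z \<in> E")
      case True
      have "(\<Sum>w\<in>\<Omega>. g (c w + z)) \<le> V"
        using V[of "fst z" "snd z"] True
        by (simp add: E \<Omega>_def c_def split_def plus_prod_def add.commute)
      thus ?thesis using True by simp
    qed simp
  qed
  also have "\<dots> = V * emeasure lborel E"
    by (rule nn_integral_cmult_indicator) simp
  also have "emeasure lborel E = ennreal (1 / (real Q)\<^sup>2)"
    unfolding E_def by (subst emeasure_lborel_cbox)
      (auto simp: Basis_prod_def prod.union_disjoint power2_eq_square inner_prod_def)
  finally show ?thesis .
qed

text \<open>The integrand is nonnegative and measurable, so its Bochner integral is the real value
  of the nonnegative integral, which is estimated over \<open>lborel\<close> and transferred to its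
  completion.\<close>

lemma Lp_norm_unit_square_le:
  fixes f :: "real \<times> real \<Rightarrow> complex"
  assumes f: "continuous_on UNIV f" and p: "p > 0" and Q: "Q > 0" and V0: "V \<ge> 0"
    and V: "\<And>x t. 0 \<le> x \<Longrightarrow> x \<le> 1 / real Q \<Longrightarrow> 0 \<le> t \<Longrightarrow> t \<le> 1 / real Q
      \<Longrightarrow> (\<Sum>(i, j)\<in>{..<Q} \<times> {..<Q}. cmod (f (x + real i / real Q, t + real j / real Q)) powr p)
        \<le> V * (real Q)\<^sup>2"
  shows "Lp_norm p (lebesgue_on ({0..1} \<times> {0..1})) f \<le> V powr (1 / p)"
proof -
  let ?U = "{0..1::real} \<times> {0..1::real}"
  define g where "g z = cmod (f z) powr p" for z
  have U: "?U \<in> sets lebesgue" using borel_closed[of ?U] by (simp add: closed_Times)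
  have [measurable]: "f \<in> borel_measurable borel" using f by (rule borel_measurable_continuous_onI)
  have g[measurable]: "g \<in> borel_measurable borel" unfolding g_def by measurable
  have "(\<integral>\<^sup>+z. ennreal (g z) * indicator ?U z \<partial>lborel) \<le> ennreal (V * (real Q)\<^sup>2) * ennreal (1 / (real Q)\<^sup>2)"
  proof (rule nn_integral_unit_square_le)
    fix x t :: real assume xt: "0 \<le> x" "x \<le> 1 / real Q" "0 \<le> t" "t \<le> 1 / real Q"
    have "(\<Sum>w\<in>{..<Q} \<times> {..<Q}. ennreal (g (x + real (fst w) / real Q, t + real (snd w) / real Q)))
      = ennreal (\<Sum>w\<in>{..<Q} \<times> {..<Q}. g (x + real (fst w) / real Q, t + real (snd w) / real Q))"
      by (rule sum_ennreal) (simp add: g_def)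
    also have "\<dots> \<le> ennreal (V * (real Q)\<^sup>2)"
      using V[OF xt] by (intro ennreal_leI) (simp add: g_def split_def)
    finally show "(\<Sum>(i, j)\<in>{..<Q} \<times> {..<Q}. ennreal (g (x + real i / real Q, t + real j / real Q)))
        \<le> ennreal (V * (real Q)\<^sup>2)" by (simp add: split_def)
  qed (use Q in auto)
  also have "\<dots> = ennreal V" using V0 Q by (simp flip: ennreal_mult)
  finally have bound: "(\<integral>\<^sup>+z. ennreal (g z) * indicator ?U z \<partial>lborel) \<le> ennreal V" .
  have "(\<integral>\<^sup>+z. ennreal (g z) \<partial>lebesgue_on ?U) = (\<integral>\<^sup>+z. ennreal (g z) * indicator ?U z \<partial>lebesgue)"
    using U by (intro nn_integral_restrict_space) simp
  also have "\<dots> = (\<integral>\<^sup>+z. ennreal (g z) * indicator ?U z \<partial>lborel)"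
    by (rule nn_integral_completion)
  finally have nn: "(\<integral>\<^sup>+z. ennreal (g z) \<partial>lebesgue_on ?U) \<le> ennreal V" using bound by simp
  have "g \<in> borel_measurable (lebesgue_on ?U)"
    by (intro measurable_restrict_space1 measurable_completion) simp
  hence "(\<integral>z. g z \<partial>lebesgue_on ?U) = enn2real (\<integral>\<^sup>+z. ennreal (g z) \<partial>lebesgue_on ?U)"
    by (rule integral_eq_nn_integral) (simp add: g_def)
  also have "\<dots> \<le> V" by (rule enn2real_leI[OF V0 nn])
  finally have "(\<integral>z. g z \<partial>lebesgue_on ?U) \<le> V" .
  moreover have "0 \<le> (\<integral>z. g z \<partial>lebesgue_on ?U)" by (simp add: g_def)
  ultimately show ?thesis unfolding Lp_norm_def g_def using p by (intro powr_mono2) auto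
qed

lemma continuous_on_perturbed_Weyl_sum: "continuous_on UNIV (perturbed_Weyl_sum k \<theta> N a)"
  unfolding perturbed_Weyl_sum_def split_def by (intro continuous_intros)

section \<open>From the sixth moment to other exponents\<close>

lemma powr_le_of_sixth_moment_large:
  fixes p D m s y :: real
  assumes "6 \<le> p" "0 \<le> y" "y \<le> s"
  shows "y powr p \<le> s powr (p - 6) * y ^ 6"
proof (cases "y = 0")
  case False
  have "y powr p = y powr (p - 6) * y powr 6" by (simp flip: powr_add)
  also have "y powr 6 = y ^ 6" using False assms by (simp add: powr_numeral)
  also have "y powr (p - 6) * y ^ 6 \<le> s powr (p - 6) * y ^ 6"
    using assms by (intro mult_right_mono powr_mono2) auto
  finally show ?thesis .
qed (use assms in auto)

text \<open>A substitute for Hoelder's inequality on a set of measure 1: below the threshold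
  \<open>l\<close> the first term dominates, above it the second. With \<open>l\<close> of the size
  of the \<open>L^6\<close> norm both terms have the same order.\<close>

lemma powr_le_of_sixth_moment_small:
  fixes p l y :: real
  assumes "p \<le> 6" "0 < p" "0 \<le> y" "0 < l"
  shows "y powr p \<le> l powr p + l powr (p - 6) * y ^ 6"
proof (cases "y \<le> l")
  case True
  hence "y powr p \<le> l powr p" using assms by (intro powr_mono2) auto
  thus ?thesis using assms by (simp add: add_increasing2)
next
  case False
  have "y powr p = y powr (p - 6) * y powr 6" by (simp flip: powr_add)
  also have "y powr 6 = y ^ 6" using False assms by (simp add: powr_numeral)
  also have "y powr (p - 6) * y ^ 6 \<le> l powr (p - 6) * y ^ 6"
    using assms False by (intro mult_right_mono powr_mono2') auto
  finally show ?thesis by (simp add: add_increasing)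
qed

theorem theorem1p3:
  fixes k :: nat and p \<epsilon> C :: real
  assumes "k \<ge> 2" and "p \<ge> 2" and "\<epsilon> > 0" and "C \<ge> 0"
  shows "\<exists>K::real. K > 0 \<and>
    (\<forall>(N::nat) (\<theta>::nat \<Rightarrow> real) (a::nat \<Rightarrow> complex).
      N \<ge> 1 \<longrightarrow> (\<forall>n\<le>N. \<bar>\<theta> n\<bar> \<le> C) \<longrightarrow>
      Lp_norm p (lebesgue_on ({0..1::real} \<times> {0..1::real}))
        (\<lambda>(x, t). \<Sum>n=0..N. a n *
           exp (2 * of_real pi * \<i> * of_real (real n * x + (real n ^ k + \<theta> n) * t)))
      \<le> K * real N powr \<epsilon> * (1 + real N powr (1 / 2 - 3 / p))
          * sqrt (\<Sum>n=0..N. (cmod (a n))\<^sup>2))"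
proof -
  obtain K where K: "K > 0" "\<And>N. N \<ge> 1 \<Longrightarrow> \<exists>Q>0. \<forall>a :: nat \<Rightarrow> complex.
    (\<Sum>w\<in>{..<Q} \<times> {..<Q}. cmod (\<Sum>n=0..N. a n * grid_char Q (int n) (int n ^ k) w) ^ 6)
    \<le> K * real N powr \<epsilon> * (real Q)\<^sup>2 * (\<Sum>n=0..N. (cmod (a n))\<^sup>2) ^ 3"
    using grid_sixth_moment[OF assms(1,3)] by blast
  define W where "W = exp (2 * pi * C)"
  \<comment> \<open>The maximum ensures \<open>K' \<ge> 1\<close>, hence \<open>D \<ge> 1\<close>
    below, so that roots of \<open>D\<close> may be replaced by \<open>D\<close> itself.\<close>
  define K' where "K' = max 1 K * W ^ 6"
  have W1: "W \<ge> 1" using assms(4) by (simp add: W_def)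
  have K'1: "K' \<ge> 1"
    unfolding K'_def using mult_mono[of 1 "max 1 K" 1 "W ^ 6"] W1 by (simp add: one_le_power)
  show ?thesis
  proof (intro exI[of _ "2 * K'"] conjI allI impI)
    show "2 * K' > 0" using K'1 by simp
    fix N :: nat and \<theta> :: "nat \<Rightarrow> real" and a :: "nat \<Rightarrow> complex"
    assume N: "N \<ge> 1" and \<theta>: "\<forall>n\<le>N. \<bar>\<theta> n\<bar> \<le> C"
    define f where "f = perturbed_Weyl_sum k \<theta> N a"
    define m where "m = (\<Sum>n=0..N. (cmod (a n))\<^sup>2)"
    define D where "D = K' * real N powr \<epsilon>"
    define L where "L = Lp_norm p (lebesgue_on ({0..1} \<times> {0..1})) f"
    have m0: "m \<ge> 0" by (simp add: m_def sum_nonneg)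
    have "real N powr \<epsilon> \<ge> 1" using N assms(3) by (simp add: ge_one_powr_ge_zero)
    hence D1: "D \<ge> 1" unfolding D_def using mult_mono[of 1 K' 1 "real N powr \<epsilon>"] K'1 by simp
    have p0: "p > 0" using assms(2) by simp
    obtain Q where Q: "Q > 0" and grid: "\<And>a :: nat \<Rightarrow> complex.
      (\<Sum>w\<in>{..<Q} \<times> {..<Q}. cmod (\<Sum>n=0..N. a n * grid_char Q (int n) (int n ^ k) w) ^ 6)
      \<le> K * real N powr \<epsilon> * (real Q)\<^sup>2 * (\<Sum>n=0..N. (cmod (a n))\<^sup>2) ^ 3"
      using K(2)[OF N] by blast
    define z where "z x t w = (x + real (fst w) / real Q, t + real (snd w) / real Q)"
      for x t :: real and w :: "nat \<times> nat"
    have six: "(\<Sum>w\<in>{..<Q} \<times> {..<Q}. cmod (f (z x t w)) ^ 6) \<le> D * m ^ 3 * (real Q)\<^sup>2"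
      if "0 \<le> t" "t \<le> 1 / real Q" for x t
    proof -
      have "(\<Sum>w\<in>{..<Q} \<times> {..<Q}. cmod (f (z x t w)) ^ 6)
          \<le> K * real N powr \<epsilon> * (real Q)\<^sup>2 * W ^ 6 * m ^ 3"
        using translated_grid_sixth_moment[OF Q _ grid, of \<theta> C t a x] \<theta> that K(1)
        by (simp add: f_def z_def W_def m_def split_def)
      also have "\<dots> = K * (W ^ 6 * real N powr \<epsilon> * (real Q)\<^sup>2 * m ^ 3)"
        by (simp add: mult_ac)
      also have "\<dots> \<le> max 1 K * (W ^ 6 * real N powr \<epsilon> * (real Q)\<^sup>2 * m ^ 3)"
        by (intro mult_right_mono) (use m0 W1 in auto)
      also have "\<dots> = D * m ^ 3 * (real Q)\<^sup>2" by (simp add: D_def K'_def mult_ac)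
      finally show ?thesis .
    qed
    have Lle: "L \<le> V powr (1 / p)"
      if "V \<ge> 0" and V: "\<And>x t. 0 \<le> t \<Longrightarrow> t \<le> 1 / real Q
        \<Longrightarrow> (\<Sum>w\<in>{..<Q} \<times> {..<Q}. cmod (f (z x t w)) powr p) \<le> V * (real Q)\<^sup>2" for V
      unfolding L_def
    proof (rule Lp_norm_unit_square_le[OF _ p0 Q that(1)])
      show "continuous_on UNIV f" unfolding f_def by (rule continuous_on_perturbed_Weyl_sum)
      fix x t :: real assume "0 \<le> t" "t \<le> 1 / real Q"
      from V[OF this, of x]
      show "(\<Sum>(i, j)\<in>{..<Q} \<times> {..<Q}. cmod (f (x + real i / real Q, t + real j / real Q)) powr p)
          \<le> V * (real Q)\<^sup>2" by (simp add: z_def split_def)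
    qed
    have sup: "cmod (f w) \<le> sqrt (m * (real N + 1))" for w
      unfolding f_def m_def by (intro real_le_rsqrt norm_perturbed_Weyl_sum_square_le)
    have "L \<le> 2 * D * (1 + real N powr (1 / 2 - 3 / p)) * sqrt m"
    \<comment> \<open>Vanishing coefficients are separated because both \<open>s\<close> and the
      threshold \<open>l\<close> have to be positive.\<close>
    proof (cases "m = 0")
      case True
      hence "cmod (f w) = 0" for w using sup[of w] by simp
      hence "L \<le> 0 powr (1 / p)" by (intro Lle) auto
      thus ?thesis using True by simp
    next
      case False
      hence m: "m > 0" using m0 by simp
      show ?thesis
      proof (cases "6 \<le> p")
        case True
        define s where "s = sqrt (m * (real N + 1))"
        define q where "q = 1 / 2 - 3 / p"
        have q: "0 \<le> q" "q \<le> 1" using True by (auto simp: q_def field_simps)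
        have s0: "s > 0" using m by (simp add: s_def)
        have "L \<le> (s powr (p - 6) * (D * m ^ 3)) powr (1 / p)"
        proof (rule Lle)
          show "0 \<le> s powr (p - 6) * (D * m ^ 3)" using D1 m by simp
          fix x t assume t: "0 \<le> t" "t \<le> 1 / real Q"
          have "(\<Sum>w\<in>{..<Q} \<times> {..<Q}. cmod (f (z x t w)) powr p)
              \<le> (\<Sum>w\<in>{..<Q} \<times> {..<Q}. s powr (p - 6) * cmod (f (z x t w)) ^ 6)"
            by (intro sum_mono powr_le_of_sixth_moment_large True) (use sup in \<open>auto simp: s_def\<close>)
          also have "\<dots> \<le> s powr (p - 6) * (D * m ^ 3 * (real Q)\<^sup>2)"
            unfolding sum_distrib_left[symmetric] by (intro mult_left_mono six t) simp
          finally show "(\<Sum>w\<in>{..<Q} \<times> {..<Q}. cmod (f (z x t w)) powr p)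
              \<le> s powr (p - 6) * (D * m ^ 3) * (real Q)\<^sup>2" by (simp add: mult_ac)
        qed
        also have "\<dots> = D powr (1 / p) * ((real N + 1) powr q * sqrt m)"
        proof -
          have "s powr (p - 6) = (m * (real N + 1)) powr ((p - 6) / 2)"
            unfolding s_def using m by (simp add: powr_half_sqrt[symmetric] powr_powr)
          hence "(s powr (p - 6) * (D * m ^ 3)) powr (1 / p)
              = (m * (real N + 1)) powr ((p - 6) / 2 * (1 / p)) * (D powr (1 / p) * (m ^ 3) powr (1 / p))"
            using m D1 by (simp add: powr_mult powr_powr)
          also have "(p - 6) / 2 * (1 / p) = q" using p0 by (simp add: q_def field_simps)
          also have "(m ^ 3) powr (1 / p) = m powr (3 / p)"
            using m by (simp add: powr_powr flip: powr_numeral)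
          also have "(m * (real N + 1)) powr q = m powr q * (real N + 1) powr q"
            using m by (simp add: powr_mult)
          also have "m powr q * (real N + 1) powr q * (D powr (1 / p) * m powr (3 / p))
              = D powr (1 / p) * ((real N + 1) powr q * m powr (q + 3 / p))"
            by (simp add: powr_add)
          \<comment> \<open>The supremum norm contributes the exponent \<open>q\<close> of
            \<open>m\<close> and the sixth moment contributes \<open>3 / p\<close>; they add up to
            1/2.\<close>
          also have "m powr (q + 3 / p) = sqrt m" using m by (simp add: q_def powr_half_sqrt)
          finally show ?thesis .
        qed
        also have "\<dots> \<le> D * ((2 * real N powr q) * sqrt m)"
        proof (intro mult_mono mult_right_mono)
          show "D powr (1 / p) \<le> D" using powr_mono[of "1 / p" 1 D] D1 assms(2) by simp
          have "(real N + 1) powr q \<le> (2 * real N) powr q"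
            using N q by (intro powr_mono2) auto
          also have "\<dots> = 2 powr q * real N powr q" by (simp add: powr_mult)
          also have "\<dots> \<le> 2 * real N powr q"
            using powr_mono[of q 1 2] q by (intro mult_right_mono) auto
          finally show "(real N + 1) powr q \<le> 2 * real N powr q" .
        qed (use D1 m in auto)
        also have "\<dots> = 2 * D * real N powr q * sqrt m" by simp
        also have "\<dots> \<le> 2 * D * (1 + real N powr q) * sqrt m"
          using D1 m by (intro mult_right_mono mult_left_mono) auto
        finally show ?thesis by (simp add: q_def)
      next
        case False
        \<comment> \<open>The \<open>L^6\<close> bound itself serves as threshold:
          \<open>l ^ 6 = D * m ^ 3\<close> makes both terms of the split equal to
          \<open>l powr p\<close>.\<close>
        define l where "l = D powr (1 / 6) * sqrt m"
        have l0: "l > 0" using D1 m by (simp add: l_def)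
        have "sqrt m ^ 6 = ((sqrt m)\<^sup>2) ^ 3" by (simp flip: power_mult)
        hence l6: "l ^ 6 = D * m ^ 3"
          using D1 m by (simp add: l_def power_mult_distrib powr_power)
        have "L \<le> (2 * l powr p) powr (1 / p)"
        proof (rule Lle)
          show "0 \<le> 2 * l powr p" by simp
          fix x t assume t: "0 \<le> t" "t \<le> 1 / real Q"
          have "(\<Sum>w\<in>{..<Q} \<times> {..<Q}. cmod (f (z x t w)) powr p)
              \<le> (\<Sum>w\<in>{..<Q} \<times> {..<Q}. l powr p + l powr (p - 6) * cmod (f (z x t w)) ^ 6)"
            by (intro sum_mono powr_le_of_sixth_moment_small) (use False p0 l0 in auto)
          also have "\<dots> = (real Q)\<^sup>2 * l powr p
              + l powr (p - 6) * (\<Sum>w\<in>{..<Q} \<times> {..<Q}. cmod (f (z x t w)) ^ 6)"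
            by (simp add: sum.distrib power2_eq_square flip: sum_distrib_left)
          also have "\<dots> \<le> (real Q)\<^sup>2 * l powr p + l powr (p - 6) * (D * m ^ 3 * (real Q)\<^sup>2)"
            by (intro add_left_mono mult_left_mono six t) simp
          also have "\<dots> = (real Q)\<^sup>2 * (l powr p + l powr (p - 6) * l ^ 6)"
            by (simp add: l6 algebra_simps)
          also have "l powr (p - 6) * l ^ 6 = l powr p"
            using l0 by (simp flip: powr_numeral powr_add)
          finally show "(\<Sum>w\<in>{..<Q} \<times> {..<Q}. cmod (f (z x t w)) powr p) \<le> 2 * l powr p * (real Q)\<^sup>2"
            by (simp add: mult_ac)
        qed
        also have "\<dots> = 2 powr (1 / p) * l" using l0 p0 by (simp add: powr_mult powr_powr)
        also have "\<dots> \<le> 2 * (D * sqrt m)"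
        proof (intro mult_mono)
          show "2 powr (1 / p) \<le> (2 :: real)" using powr_mono[of "1 / p" 1 2] assms(2) by simp
          show "l \<le> D * sqrt m" unfolding l_def
            using powr_mono[of "1 / 6" 1 D] D1 m by (intro mult_right_mono) auto
        qed (use l0 in auto)
        also have "\<dots> = 2 * D * 1 * sqrt m" by simp
        also have "\<dots> \<le> 2 * D * (1 + real N powr (1 / 2 - 3 / p)) * sqrt m"
          using D1 m by (intro mult_right_mono mult_left_mono) auto
        finally show ?thesis .
      qed
    qed
    thus "Lp_norm p (lebesgue_on ({0..1::real} \<times> {0..1::real}))
        (\<lambda>(x, t). \<Sum>n=0..N. a n *
           exp (2 * of_real pi * \<i> * of_real (real n * x + (real n ^ k + \<theta> n) * t)))
      \<le> 2 * K' * real N powr \<epsilon> * (1 + real N powr (1 / 2 - 3 / p))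
          * sqrt (\<Sum>n=0..N. (cmod (a n))\<^sup>2)"
      by (simp add: L_def f_def perturbed_Weyl_sum_def D_def m_def mult.assoc)
  qed
qed

end
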